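(* Let $q,u\in(0,1)$, let $\mathbb{T}=\mathbb{Z}/M\mathbb{Z}\times\mathbb{Z}/N\mathbb{Z}$, and let $k_1,k_2$ be arbitrary integers for which the set $\mathcal{S}_{k_1,k_2}$ of path configurations is nonempty. The continuous time Markov process $\mathcal{L}(\tau)$ on path configurations on the torus $\mathbb{T}$, with jump rates $\mathfrak{a}(u),\mathfrak{b}(u),\mathfrak{c}(u)$, preserves the stochastic six vertex Gibbs measure $\mu_{k_1,k_2}$.
   Context: **Configurations on the torus.** $M\ge1$, $N\ge2$. A path configuration on $\mathbb{T}$ assigns to every edge of the $M\times N$ torus graph the state occupied ($1$) or empty ($0$), so that at every vertex $i_1+j_1=i_2+j_2$, where $i_1,j_1,i_2,j_2\in\{0,1\}$ are the states of the bottom, left, top, right adjacent edges. The vertex type is written $(i_1,j_1;i_2,j_2)$. $\mathcal{S}_{k_1,k_2}$ is the set of configurations with overall height changes $k_1$ and $k_2$ in the $x$ and $y$ directions, that is, with exactly $k_1$ occupied vertical edges between any two consecutive rows, and exactly $k_2$ occupied horizontal edges between any two consecutive columns. **Gibbs measure.** Let $\delta_1=\frac{q(1-u)}{1-qu}$, $\delta_2=\frac{1-u}{1-qu}$, and let $w(0,0;0,0)=w(1,1;1,1)=1$, $w(1,0;1,0)=\delta_1$, $w(1,0;0,1)=1-\delta_1$, $w(0,1;0,1)=\delta_2$, $w(0,1;1,0)=1-\delta_2$. Then $\mu_{k_1,k_2}$ is the probability measure on $\mathcal{S}_{k_1,k_2}$ proportional to the product of $w$ over all vertices. **Rates.** $\mathfrak{a}(u)=\frac{(1-u)q}{(1-q)(1-qu)u}$,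 $\mathfrak{b}(u)=\frac{1-qu}{(1-u)(1-q)u}$, $\mathfrak{c}(u)=\frac{1-q}{(1-u)(1-qu)}$. **Seed pairs.** A pair $v_1=(x,y)$, $v_2=(x,y+1)$ (coordinates modulo $M$, $N$) is a seed pair if the types (type of $v_1$ / type of $v_2$) are one of the following; its rate is indicated. Up jump: $(0,1;0,1)/(0,0;0,0)$, rate $\mathfrak{c}(u)$; $(1,0;0,1)/(0,0;0,0)$, rate $\mathfrak{a}(u)$; $(0,1;0,1)/(0,1;1,0)$, rate $\mathfrak{b}(u)$. Down jump: $(1,0;1,0)/(1,1;1,1)$, rate $\mathfrak{c}(u)$; $(0,1;1,0)/(1,1;1,1)$, rate $\mathfrak{a}(u)$; $(1,0;1,0)/(1,0;0,1)$, rate $\mathfrak{b}(u)$. **The process $\mathcal{L}(\tau)$.** Each seed pair carries an independent exponential clock with its rate; when it rings, the following jump is performed. For fixed $y$ let $L_i,U_i$ be the horizontal edges $(i,y)-(i+1,y)$ and $(i,y+1)-(i+1,y+1)$, and $V_i$ the vertical edge $(i,y)-(i,y+1)$, $i\in\mathbb{Z}/M\mathbb{Z}$. For an up jump at $x$: (1) if it is not true that $L_i$ is occupied and $U_i$ is empty for all $i\in\mathbb{Z}/M\mathbb{Z}$, let $c\ge0$ be the largest integer such that $L_{x+j}$ is occupied and $U_{x+j}$ is empty for all $j=0,\ldots,c$; make $V_x$ occupied, swap the states of $L_{x+j},U_{x+j}$ for $0\le j\le c$, and change $V_{x+c+1}$ from occupied to empty; (2) if $L_i$ is occupied and $U_i$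 is empty for all $i$, the jump makes a full loop around the torus: the states of $L_i$ and $U_i$ are swapped for all $i$, and no vertical edge changes. For a down jump the same rules hold with occupied and empty interchanged. *)

theory Defs
  imports "HOL-Probability.Probability_Mass_Function"
begin

section \<open>Continuous time Markov chains on a finite state space\<close>

text \<open>
  The argument \<open>r\<close> is a table of jump rates on the finite state space \<open>C\<close>. Only its off-diagonal
  entries matter: a jump from a state to itself is no jump.
  The chain leaves \<open>s\<close> for \<open>t\<close> at rate \<open>r s t\<close>, that is, after independent exponential waiting times;
  its transition matrix over time \<open>\<tau>\<close> is the exponential of \<open>\<tau>\<close> times the generator.
\<close>

definition generator :: "'s set \<Rightarrow> ('s \<Rightarrow> 's \<Rightarrow> real) \<Rightarrow> 's \<Rightarrow> 's \<Rightarrow> real" where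
  "generator C r s t = (if s = t then - (\<Sum>z\<in>C - {s}. r s z) else r s t)"

primrec matrix_power :: "'s set \<Rightarrow> ('s \<Rightarrow> 's \<Rightarrow> real) \<Rightarrow> nat \<Rightarrow> 's \<Rightarrow> 's \<Rightarrow> real" where
  "matrix_power C A 0 s t = (if s = t then 1 else 0)"
| "matrix_power C A (Suc n) s t = (\<Sum>z\<in>C. A s z * matrix_power C A n z t)"

definition matrix_exp :: "'s set \<Rightarrow> ('s \<Rightarrow> 's \<Rightarrow> real) \<Rightarrow> real \<Rightarrow> 's \<Rightarrow> 's \<Rightarrow> real" where
  "matrix_exp C A \<tau> s t = (\<Sum>n. \<tau> ^ n / fact n * matrix_power C A n s t)"

text \<open>
  The law at time \<open>\<tau>\<close> of the chain started in \<open>s\<close>. The lemma \<open>pmf_markov_law\<close> below shows that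
  the argument of \<open>embed_pmf\<close> is a probability mass function when \<open>C\<close> is finite, the rates are
  nonnegative, \<open>s \<in> C\<close> and \<open>\<tau> \<ge> 0\<close>.
\<close>

definition markov_law :: "'s set \<Rightarrow> ('s \<Rightarrow> 's \<Rightarrow> real) \<Rightarrow> real \<Rightarrow> 's \<Rightarrow> 's pmf" where
  "markov_law C r \<tau> s = embed_pmf (\<lambda>t. if t \<in> C then matrix_exp C (generator C r) \<tau> s t else 0)"

lemma abs_matrix_power_le:
  fixes B :: real
  assumes "finite C" "\<And>s t. s \<in> C \<Longrightarrow> t \<in> C \<Longrightarrow> \<bar>A s t\<bar> \<le> B" "s \<in> C" "t \<in> C"
  shows "\<bar>matrix_power C A n s t\<bar> \<le> (card C * B) ^ n"
  using assms(3)
proof (induction n arbitrary: s)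
  case (Suc n)
  have B: "0 \<le> B"
    using assms(2)[OF Suc.prems Suc.prems] by linarith
  have "\<bar>matrix_power C A (Suc n) s t\<bar> \<le> (\<Sum>z\<in>C. \<bar>A s z * matrix_power C A n z t\<bar>)"
    by simp
  also have "\<dots> \<le> (\<Sum>z\<in>C. B * (card C * B) ^ n)"
    unfolding abs_mult using Suc assms(2) B by (intro sum_mono mult_mono) auto
  finally show ?case
    by simp
qed auto

lemma summable_matrix_exp:
  assumes "finite C" "s \<in> C" "t \<in> C"
  shows "summable (\<lambda>n. norm (\<tau> ^ n / fact n * matrix_power C A n s t))"
proof -
  define B where "B = (\<Sum>p\<in>C \<times> C. \<bar>A (fst p) (snd p)\<bar>)"
  have B: "\<bar>A x y\<bar> \<le> B" if "x \<in> C" "y \<in> C" for x y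
    using member_le_sum[of "(x, y)" "C \<times> C" "\<lambda>p. \<bar>A (fst p) (snd p)\<bar>"] assms(1) that
    unfolding B_def by simp
  have "summable (\<lambda>n. (\<bar>\<tau>\<bar> * (card C * B)) ^ n / fact n)"
    using summable_exp[of "\<bar>\<tau>\<bar> * (card C * B)"] by (simp add: field_simps)
  moreover have "norm (norm (\<tau> ^ n / fact n * matrix_power C A n s t))
      \<le> (\<bar>\<tau>\<bar> * (card C * B)) ^ n / fact n" for n
    using mult_left_mono[where c = "\<bar>\<tau>\<bar> ^ n", OF abs_matrix_power_le[where n = n, OF assms(1) B assms(2,3)]]
    by (simp add: abs_mult power_abs power_mult_distrib divide_right_mono)
  ultimately show ?thesis
    by (rule summable_comparison_test'[where N = 0])
qed

lemma matrix_power_shift: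
  assumes "finite C" "s \<in> C"
  shows "matrix_power C (\<lambda>x y. R x y - (if x = y then l else 0)) n s t / fact n =
    (\<Sum>k\<le>n. matrix_power C R k s t / fact k * ((- l) ^ (n - k) / fact (n - k)))"
  using assms(2)
proof -
  have *: "matrix_power C (\<lambda>x y. R x y - (if x = y then l else 0)) n s t =
      (\<Sum>k\<le>n. of_nat (n choose k) * matrix_power C R k s t * (- l) ^ (n - k))" if "s \<in> C" for s
    using that
  proof (induction n arbitrary: s)
    case (Suc n)
    let ?P = "\<lambda>k s. matrix_power C R k s t"
    let ?f = "\<lambda>k s. of_nat (n choose k) * ?P k s * (- l) ^ (n - k)"
    have "matrix_power C (\<lambda>x y. R x y - (if x = y then l else 0)) (Suc n) s t
        = (\<Sum>z\<in>C. (R s z - (if s = z then l else 0)) * (\<Sum>k\<le>n. ?f k z))"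
      using Suc.IH by simp
    also have "\<dots> = (\<Sum>z\<in>C. R s z * (\<Sum>k\<le>n. ?f k z)) - (\<Sum>z\<in>C. (if s = z then l * (\<Sum>k\<le>n. ?f k z) else 0))"
      unfolding sum_subtractf[symmetric] by (intro sum.cong) (auto simp: algebra_simps)
    also have "(\<Sum>z\<in>C. (if s = z then l * (\<Sum>k\<le>n. ?f k z) else 0)) = l * (\<Sum>k\<le>n. ?f k s)"
      using Suc.prems assms(1) by simp
    also have "(\<Sum>z\<in>C. R s z * (\<Sum>k\<le>n. ?f k z)) =
        (\<Sum>k\<le>n. of_nat (n choose k) * ?P (Suc k) s * (- l) ^ (n - k))"
      unfolding sum_distrib_left matrix_power.simps sum_distrib_right
      by (subst sum.swap) (intro sum.cong, auto simp: algebra_simps)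
    also have "\<dots> - l * (\<Sum>k\<le>n. ?f k s) =
        (\<Sum>k\<le>n. of_nat (n choose k) * ?P (Suc k) s * (- l) ^ (n - k)) +
        (\<Sum>k\<le>n. of_nat (n choose k) * ?P k s * (- l) ^ (Suc n - k))"
      by (simp add: sum_distrib_left Suc_diff_le sum_negf algebra_simps)
    also have "(\<Sum>k\<le>n. of_nat (n choose k) * ?P k s * (- l) ^ (Suc n - k)) =
        (\<Sum>k\<le>Suc n. of_nat (n choose k) * ?P k s * (- l) ^ (Suc n - k))"
      by (simp add: binomial_eq_0)
    also have "\<dots> = ?P 0 s * (- l) ^ Suc n +
        (\<Sum>k\<le>n. of_nat (n choose Suc k) * ?P (Suc k) s * (- l) ^ (n - k))"
      by (subst sum.atMost_Suc_shift) (simp del: matrix_power.simps)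
    also have "(\<Sum>k\<le>n. of_nat (n choose k) * ?P (Suc k) s * (- l) ^ (n - k)) + \<dots> =
        (\<Sum>k\<le>Suc n. of_nat (Suc n choose k) * ?P k s * (- l) ^ (Suc n - k))"
      unfolding sum.atMost_Suc_shift[of "\<lambda>k. of_nat (Suc n choose k) * ?P k s * (- l) ^ (Suc n - k)"]
      by (simp del: matrix_power.simps add: sum.distrib[symmetric] algebra_simps)
    finally show ?case .
  qed simp
  show ?thesis
    unfolding *[OF assms(2)] sum_divide_distrib
    by (intro sum.cong) (auto simp: binomial_fact field_simps)
qed

lemma matrix_exp_nonneg:
  assumes "finite C" "s \<in> C" "t \<in> C" "\<tau> \<ge> 0"
    and offdiag: "\<And>x y. x \<in> C \<Longrightarrow> y \<in> C \<Longrightarrow> x \<noteq> y \<Longrightarrow> A x y \<ge> 0"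
  shows "matrix_exp C A \<tau> s t \<ge> 0"
proof -
  define l where "l = (\<Sum>x\<in>C. \<bar>A x x\<bar>)"
  define R where "R = (\<lambda>x y. A x y + (if x = y then l else 0))"
  have "\<bar>A x x\<bar> \<le> l" if "x \<in> C" for x
    unfolding l_def using assms(1) that by (intro member_le_sum) auto
  then have R: "R x y \<ge> 0" if "x \<in> C" "y \<in> C" for x y
    using offdiag[OF that] that by (force simp: R_def)
  have P: "matrix_power C R n x t \<ge> 0" if "x \<in> C" for n x
    using that by (induction n arbitrary: x) (auto intro!: sum_nonneg mult_nonneg_nonneg R)
  have A: "A = (\<lambda>x y. R x y - (if x = y then l else 0))"
    by (auto simp: R_def)
  let ?a = "\<lambda>k. \<tau> ^ k / fact k * matrix_power C R k s t"
  let ?b = "\<lambda>k. (- l * \<tau>) ^ k / fact k"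
  have "(\<lambda>n. \<Sum>k\<le>n. ?a k * ?b (n - k)) = (\<lambda>n. \<tau> ^ n / fact n * matrix_power C A n s t)"
  proof
    fix n
    have "\<tau> ^ n / fact n * matrix_power C A n s t = \<tau> ^ n * (matrix_power C A n s t / fact n)"
      by simp
    also have "\<dots> = (\<Sum>k\<le>n. ?a k * ?b (n - k))"
      unfolding A matrix_power_shift[OF assms(1,2)] sum_distrib_left
    proof (intro sum.cong refl, goal_cases)
      case (1 k)
      then have "\<tau> ^ n = \<tau> ^ k * \<tau> ^ (n - k)"
        by (simp flip: power_add)
      moreover have "(- l * \<tau>) ^ (n - k) = (- l) ^ (n - k) * \<tau> ^ (n - k)"
        by (rule power_mult_distrib)
      ultimately show ?case
        by simp
    qed
    finally show "(\<Sum>k\<le>n. ?a k * ?b (n - k)) = \<tau> ^ n / fact n * matrix_power C A n s t"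
      by simp
  qed
  moreover have "(\<lambda>n. \<Sum>k\<le>n. ?a k * ?b (n - k)) sums ((\<Sum>k. ?a k) * (\<Sum>k. ?b k))"
    using summable_norm_exp[of "- l * \<tau>"]
    by (intro Cauchy_product_sums summable_matrix_exp assms) (simp add: field_simps)
  ultimately have "matrix_exp C A \<tau> s t = (\<Sum>k. ?a k) * (\<Sum>k. ?b k)"
    unfolding matrix_exp_def by (simp add: sums_iff)
  moreover have "(\<Sum>k. ?b k) = exp (- l * \<tau>)"
    by (simp add: exp_def field_simps)
  moreover have "(\<Sum>k. ?a k) \<ge> 0"
    using assms by (intro suminf_nonneg summable_norm_cancel[OF summable_matrix_exp])
      (auto intro!: mult_nonneg_nonneg divide_nonneg_nonneg P)
  ultimately show ?thesis
    by simp
qed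

lemma sum_generator:
  assumes "finite C" "s \<in> C"
  shows "(\<Sum>t\<in>C. generator C r s t) = 0"
proof -
  have "(\<Sum>t\<in>C - {s}. generator C r s t) = (\<Sum>t\<in>C - {s}. r s t)"
    by (intro sum.cong) (auto simp: generator_def)
  then show ?thesis
    using assms by (simp add: sum.remove) (simp add: generator_def)
qed

lemma sum_matrix_exp_generator:
  assumes "finite C" "s \<in> C"
  shows "(\<Sum>t\<in>C. matrix_exp C (generator C r) \<tau> s t) = 1"
proof -
  let ?P = "matrix_power C (generator C r)"
  have P: "(\<Sum>t\<in>C. ?P n x t) = (if n = 0 then 1 else 0)" if "x \<in> C" for n x
    using that
  proof (induction n arbitrary: x)
    case (Suc n)
    have "(\<Sum>t\<in>C. ?P (Suc n) x t) = (\<Sum>z\<in>C. generator C r x z * (\<Sum>t\<in>C. ?P n z t))"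
      unfolding matrix_power.simps sum_distrib_left by (rule sum.swap)
    also have "\<dots> = (\<Sum>z\<in>C. generator C r x z) * (if n = 0 then 1 else 0)"
      unfolding sum_distrib_right by (intro sum.cong) (simp_all add: Suc.IH)
    finally show ?case
      by (simp add: sum_generator assms Suc.prems)
  qed (use assms in simp)
  have "(\<Sum>t\<in>C. matrix_exp C (generator C r) \<tau> s t) =
      (\<Sum>n. \<Sum>t\<in>C. \<tau> ^ n / fact n * ?P n s t)"
    unfolding matrix_exp_def
    by (intro suminf_sum[symmetric] summable_norm_cancel[OF summable_matrix_exp] assms)
  also have "\<dots> = (\<Sum>n. if n = 0 then 1 else 0)"
    unfolding sum_distrib_left[symmetric] by (intro suminf_cong) (simp add: P assms)
  also have "\<dots> = 1"
    using suminf_finite[of "{0}" "\<lambda>n::nat. if n = 0 then 1 else 0 :: real"] by simp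
  finally show ?thesis .
qed

lemma pmf_embed_finite:
  assumes "finite C" "\<And>t. t \<in> C \<Longrightarrow> f t \<ge> 0" "(\<Sum>t\<in>C. f t) = (1 :: real)"
  shows "pmf (embed_pmf (\<lambda>t. if t \<in> C then f t else 0)) t = (if t \<in> C then f t else 0)"
proof (rule pmf_embed_pmf)
  have "(\<integral>\<^sup>+ t. ennreal (if t \<in> C then f t else 0) \<partial>count_space UNIV) =
      (\<Sum>t\<in>C. ennreal (if t \<in> C then f t else 0))"
    using assms(1) by (intro nn_integral_count_space'[of C]) auto
  also have "\<dots> = ennreal (\<Sum>t\<in>C. f t)"
    using assms(2) by (subst sum_ennreal[symmetric]) (auto intro!: sum.cong)
  finally show "(\<integral>\<^sup>+ t. ennreal (if t \<in> C then f t else 0) \<partial>count_space UNIV) = 1"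
    using assms(3) by simp
qed (use assms in auto)

lemma pmf_markov_law:
  assumes "finite C" "\<And>x y. x \<in> C \<Longrightarrow> y \<in> C \<Longrightarrow> r x y \<ge> 0" "s \<in> C" "\<tau> \<ge> 0"
  shows "pmf (markov_law C r \<tau> s) t = (if t \<in> C then matrix_exp C (generator C r) \<tau> s t else 0)"
  unfolding markov_law_def using assms
  by (intro pmf_embed_finite matrix_exp_nonneg sum_matrix_exp_generator) (auto simp: generator_def)


section \<open>Path configurations on the torus\<close>

text \<open>
  The vertices are the pairs \<open>(x, y)\<close> with \<open>x < M\<close> and \<open>y < N\<close>. The edge \<open>Hor x y\<close> joins \<open>(x, y)\<close> to
  \<open>(x + 1, y)\<close> and \<open>Ver x y\<close> joins \<open>(x, y)\<close> to \<open>(x, y + 1)\<close>, coordinates modulo \<open>M\<close> and \<open>N\<close>.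
  In particular loops (\<open>M = 1\<close>) and double edges (\<open>M = 2\<close> or \<open>N = 2\<close>) are kept apart.
\<close>

datatype edge = Hor nat nat | Ver nat nat

type_synonym config = "edge \<Rightarrow> nat"

definition torus_edges :: "nat \<Rightarrow> nat \<Rightarrow> edge set" where
  "torus_edges M N = {Hor x y | x y. x < M \<and> y < N} \<union> {Ver x y | x y. x < M \<and> y < N}"

type_synonym vertex_type = "nat \<times> nat \<times> nat \<times> nat"

text \<open>The components are the states of the bottom, left, top and right edges at \<open>(x, y)\<close>.\<close>

definition vertex_type :: "nat \<Rightarrow> nat \<Rightarrow> config \<Rightarrow> nat \<Rightarrow> nat \<Rightarrow> vertex_type" where
  "vertex_type M N \<sigma> x y =
    (\<sigma> (Ver x ((y + N - 1) mod N)), \<sigma> (Hor ((x + M - 1) mod M) y), \<sigma> (Ver x y), \<sigma> (Hor x y))"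

definition path_configs :: "nat \<Rightarrow> nat \<Rightarrow> config set" where
  "path_configs M N = {\<sigma> \<in> torus_edges M N \<rightarrow>\<^sub>E {0, 1}.
     \<forall>x<M. \<forall>y<N. case vertex_type M N \<sigma> x y of (i\<^sub>1, j\<^sub>1, i\<^sub>2, j\<^sub>2) \<Rightarrow> i\<^sub>1 + j\<^sub>1 = i\<^sub>2 + j\<^sub>2}"

definition height_configs :: "nat \<Rightarrow> nat \<Rightarrow> int \<Rightarrow> int \<Rightarrow> config set" where
  "height_configs M N k\<^sub>1 k\<^sub>2 = {\<sigma> \<in> path_configs M N.
     (\<forall>y<N. int (\<Sum>x<M. \<sigma> (Ver x y)) = k\<^sub>1) \<and> (\<forall>x<M. int (\<Sum>y<N. \<sigma> (Hor x y)) = k\<^sub>2)}"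


lemma finite_torus_edges: "finite (torus_edges M N)"
proof -
  have "torus_edges M N =
      case_prod Hor ` ({..<M} \<times> {..<N}) \<union> case_prod Ver ` ({..<M} \<times> {..<N})"
    by (auto simp: torus_edges_def)
  then show ?thesis
    by simp
qed

lemma finite_path_configs: "finite (path_configs M N)"
  unfolding path_configs_def by (rule finite_subset[OF Collect_subset])
    (simp add: finite_PiE finite_torus_edges)

lemma finite_height_configs: "finite (height_configs M N k\<^sub>1 k\<^sub>2)"
  unfolding height_configs_def by (simp add: finite_path_configs)


section \<open>The stochastic six vertex Gibbs measure\<close>

definition delta1 :: "real \<Rightarrow> real \<Rightarrow> real" where
  "delta1 q u = q * (1 - u) / (1 - q * u)"

definition delta2 :: "real \<Rightarrow> real \<Rightarrow> real" where
  "delta2 q u = (1 - u) / (1 - q * u)"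

definition vertex_weight :: "real \<Rightarrow> real \<Rightarrow> vertex_type \<Rightarrow> real" where
  "vertex_weight q u t =
    (if t = (0, 0, 0, 0) \<or> t = (1, 1, 1, 1) then 1
     else if t = (1, 0, 1, 0) then delta1 q u
     else if t = (1, 0, 0, 1) then 1 - delta1 q u
     else if t = (0, 1, 0, 1) then delta2 q u
     else if t = (0, 1, 1, 0) then 1 - delta2 q u
     else 0)"

definition config_weight :: "nat \<Rightarrow> nat \<Rightarrow> real \<Rightarrow> real \<Rightarrow> config \<Rightarrow> real" where
  "config_weight M N q u \<sigma> = (\<Prod>x<M. \<Prod>y<N. vertex_weight q u (vertex_type M N \<sigma> x y))"

definition gibbs :: "nat \<Rightarrow> nat \<Rightarrow> real \<Rightarrow> real \<Rightarrow> int \<Rightarrow> int \<Rightarrow> config pmf" where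
  "gibbs M N q u k\<^sub>1 k\<^sub>2 = embed_pmf (\<lambda>\<sigma>.
     if \<sigma> \<in> height_configs M N k\<^sub>1 k\<^sub>2
     then config_weight M N q u \<sigma> / (\<Sum>\<eta>\<in>height_configs M N k\<^sub>1 k\<^sub>2. config_weight M N q u \<eta>)
     else 0)"

lemma delta_bounds:
  assumes "0 < q" "q < 1" "0 < u" "u < 1"
  shows "0 < delta1 q u" "delta1 q u < 1" "0 < delta2 q u" "delta2 q u < 1"
proof -
  have "q * u < u" "q * u < q" "q * u < 1"
    using assms mult_strict_mono[of q 1 u 1] by simp_all
  then show "0 < delta1 q u" "delta1 q u < 1" "0 < delta2 q u" "delta2 q u < 1"
    using assms(1,2,4) unfolding delta1_def delta2_def
    by (simp_all add: right_diff_distrib pos_divide_less_eq)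
qed

lemma vertex_weight_pos:
  assumes "0 < q" "q < 1" "0 < u" "u < 1"
    and "{i\<^sub>1, j\<^sub>1, i\<^sub>2, j\<^sub>2} \<subseteq> {0, 1}" "i\<^sub>1 + j\<^sub>1 = i\<^sub>2 + j\<^sub>2"
  shows "vertex_weight q u (i\<^sub>1, j\<^sub>1, i\<^sub>2, j\<^sub>2) > 0"
proof -
  have "(i\<^sub>1, j\<^sub>1, i\<^sub>2, j\<^sub>2) \<in> {(0, 0, 0, 0), (1, 1, 1, 1), (1, 0, 1, 0), (1, 0, 0, 1), (0, 1, 0, 1), (0, 1, 1, 0)}"
    using assms(5,6) by auto
  then show ?thesis
    using delta_bounds[OF assms(1-4)] by (elim insertE emptyE) (simp_all add: vertex_weight_def)
qed

lemma config_weight_pos: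
  assumes "0 < q" "q < 1" "0 < u" "u < 1" "M \<ge> 1" "N \<ge> 1" "\<sigma> \<in> path_configs M N"
  shows "config_weight M N q u \<sigma> > 0"
  unfolding config_weight_def
proof (intro prod_pos ballI)
  fix x y assume xy: "x \<in> {..<M}" "y \<in> {..<N}"
  have bin: "\<sigma> e \<in> {0, 1}" if "e \<in> torus_edges M N" for e
    using assms(7) that by (auto simp: path_configs_def)
  have "Ver x ((y + N - 1) mod N) \<in> torus_edges M N" "Hor ((x + M - 1) mod M) y \<in> torus_edges M N"
      "Ver x y \<in> torus_edges M N" "Hor x y \<in> torus_edges M N"
    using xy assms(5,6) by (auto simp: torus_edges_def)
  note this[THEN bin]
  moreover have "case vertex_type M N \<sigma> x y of (i\<^sub>1, j\<^sub>1, i\<^sub>2, j\<^sub>2) \<Rightarrow> i\<^sub>1 + j\<^sub>1 = i\<^sub>2 + j\<^sub>2"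
    using assms(7) xy by (simp add: path_configs_def)
  ultimately show "vertex_weight q u (vertex_type M N \<sigma> x y) > 0"
    unfolding vertex_type_def prod.case using assms(1-4) by (intro vertex_weight_pos) simp_all
qed

lemma pmf_gibbs:
  assumes "0 < q" "q < 1" "0 < u" "u < 1" "M \<ge> 1" "N \<ge> 1" "height_configs M N k\<^sub>1 k\<^sub>2 \<noteq> {}"
  shows "pmf (gibbs M N q u k\<^sub>1 k\<^sub>2) \<sigma> =
    (if \<sigma> \<in> height_configs M N k\<^sub>1 k\<^sub>2
     then config_weight M N q u \<sigma> / (\<Sum>\<eta>\<in>height_configs M N k\<^sub>1 k\<^sub>2. config_weight M N q u \<eta>)
     else 0)"
proof -
  let ?S = "height_configs M N k\<^sub>1 k\<^sub>2"
  have pos: "config_weight M N q u \<eta> > 0" if "\<eta> \<in> ?S" for \<eta>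
    using that assms by (intro config_weight_pos) (auto simp: height_configs_def)
  then have Z: "(\<Sum>\<eta>\<in>?S. config_weight M N q u \<eta>) > 0"
    using assms(7) finite_height_configs by (intro sum_pos)
  show ?thesis
    unfolding gibbs_def
  proof (rule pmf_embed_finite[OF finite_height_configs])
    show "(\<Sum>\<sigma>\<in>?S. config_weight M N q u \<sigma> / (\<Sum>\<eta>\<in>?S. config_weight M N q u \<eta>)) = 1"
      using Z by (simp flip: sum_divide_distrib)
  qed (use pos Z in \<open>simp add: less_imp_le\<close>)
qed


section \<open>The jump process\<close>

definition rate_a :: "real \<Rightarrow> real \<Rightarrow> real" where
  "rate_a q u = (1 - u) * q / ((1 - q) * (1 - q * u) * u)"

definition rate_b :: "real \<Rightarrow> real \<Rightarrow> real" where
  "rate_b q u = (1 - q * u) / ((1 - u) * (1 - q) * u)"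

definition rate_c :: "real \<Rightarrow> real \<Rightarrow> real" where
  "rate_c q u = (1 - q) / ((1 - u) * (1 - q * u))"

text \<open>
  The rate of the clock carried by the pair \<open>(x, y)\<close>, \<open>(x, y + 1)\<close>; it is \<open>0\<close> if this is not a seed
  pair for an up (respectively down) jump.
\<close>

definition up_rate :: "nat \<Rightarrow> nat \<Rightarrow> real \<Rightarrow> real \<Rightarrow> config \<Rightarrow> nat \<Rightarrow> nat \<Rightarrow> real" where
  "up_rate M N q u \<sigma> x y =
    (let p = (vertex_type M N \<sigma> x y, vertex_type M N \<sigma> x ((y + 1) mod N)) in
     if p = ((0, 1, 0, 1), (0, 0, 0, 0)) then rate_c q u
     else if p = ((1, 0, 0, 1), (0, 0, 0, 0)) then rate_a q u
     else if p = ((0, 1, 0, 1), (0, 1, 1, 0)) then rate_b q u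
     else 0)"

definition down_rate :: "nat \<Rightarrow> nat \<Rightarrow> real \<Rightarrow> real \<Rightarrow> config \<Rightarrow> nat \<Rightarrow> nat \<Rightarrow> real" where
  "down_rate M N q u \<sigma> x y =
    (let p = (vertex_type M N \<sigma> x y, vertex_type M N \<sigma> x ((y + 1) mod N)) in
     if p = ((1, 0, 1, 0), (1, 1, 1, 1)) then rate_c q u
     else if p = ((0, 1, 1, 0), (1, 1, 1, 1)) then rate_a q u
     else if p = ((1, 0, 1, 0), (1, 0, 0, 1)) then rate_b q u
     else 0)"

text \<open>
  The parameter \<open>a\<close> is \<open>1\<close> for an up jump and \<open>0\<close> for a down jump, so that \<open>a\<close> and \<open>1 - a\<close> are
  "occupied" and "empty" for an up jump, and the other way round for a down jump.
\<close>

definition swappable :: "nat \<Rightarrow> nat \<Rightarrow> nat \<Rightarrow> config \<Rightarrow> nat \<Rightarrow> nat \<Rightarrow> bool" where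
  "swappable M N a \<sigma> y i \<longleftrightarrow>
     \<sigma> (Hor (i mod M) y) = a \<and> \<sigma> (Hor (i mod M) ((y + 1) mod N)) = 1 - a"

definition swap_rows :: "nat \<Rightarrow> nat \<Rightarrow> nat set \<Rightarrow> config \<Rightarrow> config" where
  "swap_rows N y I \<sigma> = (\<lambda>e. case e of
      Hor i z \<Rightarrow>
        if i \<in> I \<and> z = y then \<sigma> (Hor i ((y + 1) mod N))
        else if i \<in> I \<and> z = (y + 1) mod N then \<sigma> (Hor i y)
        else \<sigma> e
    | Ver i z \<Rightarrow> \<sigma> e)"

definition jump :: "nat \<Rightarrow> nat \<Rightarrow> nat \<Rightarrow> nat \<Rightarrow> nat \<Rightarrow> config \<Rightarrow> config" where
  "jump M N a x y \<sigma> =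
    (if \<forall>i<M. swappable M N a \<sigma> y i
     then swap_rows N y {..<M} \<sigma>
     else let c = (GREATEST c. \<forall>j\<le>c. swappable M N a \<sigma> y (x + j)) in
       (swap_rows N y {(x + j) mod M | j. j \<le> c} \<sigma>)
         (Ver x y := a, Ver ((x + c + 1) mod M) y := 1 - a))"

text \<open>
  Different clocks may lead to the same configuration (a full loop, for instance); by independence
  their rates add up.
\<close>

definition jump_rate :: "nat \<Rightarrow> nat \<Rightarrow> real \<Rightarrow> real \<Rightarrow> config \<Rightarrow> config \<Rightarrow> real" where
  "jump_rate M N q u \<sigma> \<eta> =
    (\<Sum>x<M. \<Sum>y<N. (if jump M N 1 x y \<sigma> = \<eta> then up_rate M N q u \<sigma> x y else 0)
                + (if jump M N 0 x y \<sigma> = \<eta> then down_rate M N q u \<sigma> x y else 0))"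

text \<open>The law of \<open>\<L>(\<tau>)\<close> when \<open>\<L>(0) = \<sigma>\<close>.\<close>

definition process_law :: "nat \<Rightarrow> nat \<Rightarrow> real \<Rightarrow> real \<Rightarrow> real \<Rightarrow> config \<Rightarrow> config pmf" where
  "process_law M N q u \<tau> \<sigma> = markov_law (path_configs M N) (jump_rate M N q u) \<tau> \<sigma>"

lemma jump_rate_nonneg:
  assumes "0 < q" "q < 1" "0 < u" "u < 1"
  shows "jump_rate M N q u \<sigma> \<eta> \<ge> 0"
proof -
  have "q * u < u" "q * u < q" "q * u < 1"
    using assms mult_strict_mono[of q 1 u 1] by simp_all
  then have "rate_a q u \<ge> 0" "rate_b q u \<ge> 0" "rate_c q u \<ge> 0"
    using assms unfolding rate_a_def rate_b_def rate_c_def by simp_all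
  then show ?thesis
    by (auto simp: jump_rate_def up_rate_def down_rate_def Let_def intro!: sum_nonneg add_nonneg_nonneg)
qed

lemma pmf_process_law:
  assumes "0 < q" "q < 1" "0 < u" "u < 1" "\<tau> \<ge> 0" "\<sigma> \<in> path_configs M N"
  shows "pmf (process_law M N q u \<tau> \<sigma>) \<eta> =
    (if \<eta> \<in> path_configs M N
     then matrix_exp (path_configs M N) (generator (path_configs M N) (jump_rate M N q u)) \<tau> \<sigma> \<eta>
     else 0)"
  unfolding process_law_def using assms
  by (intro pmf_markov_law finite_path_configs jump_rate_nonneg)

end

theory Submission
  imports Defs
begin

text \<open>
  A path configuration in \<open>\<S>\<close> with a jump starting in column \<open>x\<close> is sent to the configuration
  \<open>\<eta>\<close> after the jump together with the column \<open>z\<close> where the jump ends. The start and the end of the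
  jump change the weight in such a way that (weight before) times (rate of the jump) is (weight
  of \<open>\<eta>\<close>) times a rate that only depends on the two vertices of \<open>\<eta>\<close> in column \<open>z\<close>. These
  reversed rates and the original rates have the same sum over all vertices of \<open>\<eta>\<close>, as they
  differ by discrete gradients in the \<open>x\<close> and \<open>y\<close> directions, which sum to zero on a torus. Since the map
  above is injective, the weighted inflow into \<open>\<eta>\<close> is at most its weighted outflow; as total inflow
  and total outflow agree, equality holds everywhere and the Gibbs measure is stationary.
\<close>

section \<open>Stationary distributions of finite chains\<close>

text \<open>If p annihilates the generator G from the left, then it annihilates every power of G
  from the first on, so only the zeroth term of the exponential series, the identity, acts on
  p.\<close>

lemma bind_markov_law_stationary:
  assumes fin: "finite C" and r: "\<And>x y. x \<in> C \<Longrightarrow> y \<in> C \<Longrightarrow> r x y \<ge> 0"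
    and p: "set_pmf p \<subseteq> C" and \<tau>: "\<tau> \<ge> 0"
    and stationary: "\<And>t. t \<in> C \<Longrightarrow> (\<Sum>s\<in>C. pmf p s * generator C r s t) = 0"
  shows "bind_pmf p (markov_law C r \<tau>) = p"
proof (rule pmf_eqI)
  fix t
  let ?P = "matrix_power C (generator C r)"
  have law: "pmf (markov_law C r \<tau> s) t = (if t \<in> C then matrix_exp C (generator C r) \<tau> s t else 0)"
    if "s \<in> C" for s
    using pmf_markov_law[OF fin r that \<tau>] .
  have "pmf (bind_pmf p (markov_law C r \<tau>)) t = (\<Sum>s\<in>C. pmf (markov_law C r \<tau> s) t * pmf p s)"
    unfolding pmf_bind using fin p by (intro integral_measure_pmf_real) auto
  also have "\<dots> = pmf p t"
  proof (cases "t \<in> C")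
    case True
    have P: "(\<Sum>s\<in>C. pmf p s * ?P n s t) = (if n = 0 then pmf p t else 0)" for n
    proof (cases n)
      case 0
      then show ?thesis
        using fin True by (simp add: if_distrib[of "\<lambda>x. _ * x"] cong: if_cong)
    next
      case (Suc m)
      have "(\<Sum>s\<in>C. pmf p s * ?P (Suc m) s t) =
          (\<Sum>z\<in>C. \<Sum>s\<in>C. pmf p s * generator C r s z * ?P m z t)"
        by (subst sum.swap) (simp add: sum_distrib_left mult.assoc)
      also have "\<dots> = 0"
        by (simp add: sum_distrib_right[symmetric] stationary)
      finally show ?thesis
        using Suc by simp
    qed
    \<comment> \<open>The state space is finite and each entry of the exponential series is
      summable, so the sum over initial states can be moved inside the series and \<open>P\<close>
      applied term by term.\<close>
    have "(\<Sum>s\<in>C. pmf (markov_law C r \<tau> s) t * pmf p s) =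
        (\<Sum>s\<in>C. \<Sum>n. \<tau> ^ n / fact n * ?P n s t * pmf p s)"
    proof (intro sum.cong refl, goal_cases)
      case (1 s)
      show ?case
        using True unfolding law[OF 1] matrix_exp_def
        by (simp only: if_True suminf_mult2[OF summable_norm_cancel[OF summable_matrix_exp[OF fin 1 True]]])
    qed
    also have "\<dots> = (\<Sum>n. \<Sum>s\<in>C. \<tau> ^ n / fact n * ?P n s t * pmf p s)"
      using True fin by (intro suminf_sum[symmetric] summable_mult2
          summable_norm_cancel[OF summable_matrix_exp])
    also have "\<dots> = (\<Sum>n. if n = 0 then pmf p t else 0)"
    proof (rule suminf_cong)
      fix n
      have "(\<Sum>s\<in>C. \<tau> ^ n / fact n * ?P n s t * pmf p s) =
          \<tau> ^ n / fact n * (\<Sum>s\<in>C. pmf p s * ?P n s t)"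
        by (simp add: sum_distrib_left mult_ac)
      then show "(\<Sum>s\<in>C. \<tau> ^ n / fact n * ?P n s t * pmf p s) = (if n = 0 then pmf p t else 0)"
        by (simp add: P)
    qed
    also have "\<dots> = pmf p t"
      using suminf_finite[of "{0}" "\<lambda>n::nat. if n = 0 then pmf p t else 0"] by simp
    finally show ?thesis .
  next
    case False
    then have "pmf p t = 0"
      using p by (auto simp: pmf_eq_0_set_pmf)
    then show ?thesis
      using False by (simp add: law)
  qed
  finally show "pmf (bind_pmf p (markov_law C r \<tau>)) t = pmf p t" .
qed

section \<open>Cyclic indices\<close>

text \<open>The truncation-free form of i - 1 modulo M that occurs in \<open>vertex_type\<close>.
  Under a name of its own it can be cancelled against the cyclic successor.\<close>

definition cyc_pred :: "nat \<Rightarrow> nat \<Rightarrow> nat" where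
  "cyc_pred M i = (i + M - 1) mod M"

lemma add_mod_eq: "i < M \<Longrightarrow> j \<le> M \<Longrightarrow> (i + j) mod M = (if i + j < M then i + j else i + j - M)"
  for i j M :: nat
  by (simp add: le_mod_geq)

lemma Suc_mod_eq: "i < M \<Longrightarrow> Suc i mod M = (if Suc i = M then 0 else Suc i)"
  by auto

lemma cyc_pred_eq: "i < M \<Longrightarrow> cyc_pred M i = (if i = 0 then M - 1 else i - 1)"
  using add_mod_eq[of i M "M - 1"] by (auto simp: cyc_pred_def)

lemma cyc_pred_less: "i < M \<Longrightarrow> cyc_pred M i < M"
  by (simp add: cyc_pred_def)

lemma cyc_pred_Suc_mod: "i < M \<Longrightarrow> cyc_pred M ((i + 1) mod M) = i"
  by (cases "i + 1 = M") (auto simp: cyc_pred_eq)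

lemma Suc_cyc_pred_mod: "i < M \<Longrightarrow> (cyc_pred M i + 1) mod M = i"
  by (auto simp: cyc_pred_eq)

lemma sum_cyc_pred: "(\<Sum>i<M. f (cyc_pred M i)) = (\<Sum>i<M. f i)" for M :: nat
  by (rule sum.reindex_bij_betw, rule bij_betw_byWitness[where f' = "\<lambda>i. (i + 1) mod M"])
    (auto simp: Suc_cyc_pred_mod cyc_pred_Suc_mod cyc_pred_less simp del: One_nat_def add_Suc_right)

lemma sum_Suc_mod: "(\<Sum>i<M. f ((i + 1) mod M)) = (\<Sum>i<M. f i)" for M :: nat
  by (rule sum.reindex_bij_betw, rule bij_betw_byWitness[where f' = "cyc_pred M"])
    (auto simp: Suc_cyc_pred_mod cyc_pred_Suc_mod cyc_pred_less simp del: One_nat_def add_Suc_right)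

section \<open>Arcs of consecutive columns on the cycle\<close>

definition arc :: "nat \<Rightarrow> nat \<Rightarrow> nat \<Rightarrow> nat set" where
  "arc M x c = {(x + j) mod M | j. j \<le> c}"

lemma arc_subset: "M > 0 \<Longrightarrow> arc M x c \<subseteq> {..<M}"
  by (auto simp: arc_def)

text \<open>As c < M, a column is reached from x by at most one offset up to c: i - x, or i + M - x
  if the arc wraps around. This turns questions about arcs into linear arithmetic.\<close>

lemma mem_arc:
  assumes "x < M" "c < M" "i < M"
  shows "i \<in> arc M x c \<longleftrightarrow> (if x \<le> i then i \<le> x + c else i + M \<le> x + c)"
proof
  assume "i \<in> arc M x c"
  then obtain j where "j \<le> c" "i = (x + j) mod M"
    by (auto simp: arc_def)
  then show "if x \<le> i then i \<le> x + c else i + M \<le> x + c"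
    using assms add_mod_eq[of x M j] by auto
next
  assume *: "if x \<le> i then i \<le> x + c else i + M \<le> x + c"
  let ?j = "if x \<le> i then i - x else i + M - x"
  have "?j \<le> c" "i = (x + ?j) mod M"
    using * assms by (auto split: if_splits)
  then show "i \<in> arc M x c"
    unfolding arc_def by blast
qed

lemma cyc_pred_mem_arc:
  assumes "x < M" "c < M" "i < M"
  shows "cyc_pred M i \<in> arc M x c \<longleftrightarrow>
    (if i = 0 then M \<le> x + c + 1 else if x < i then i \<le> x + c + 1 else i + M \<le> x + c + 1)"
  using mem_arc[OF assms(1,2) cyc_pred_less[OF assms(3)]] assms
  by (auto simp: cyc_pred_eq split: if_splits)

text \<open>The vertex in column i has its left edges in column \<open>cyc_pred M i\<close> and its
  right edges in column i. If the arc is not the whole cycle, exactly one of these columns belongs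
  to it at the start x and at z, just behind the arc; at all other vertices both or neither
  do.\<close>

lemma arc_boundary:
  assumes "x < M" "c + 1 < M" and z: "z = (x + c + 1) mod M"
  shows "z < M" "z \<noteq> x" "x \<in> arc M x c" "cyc_pred M x \<notin> arc M x c"
    "z \<notin> arc M x c" "cyc_pred M z \<in> arc M x c"
    "\<And>i. i < M \<Longrightarrow> i \<noteq> x \<Longrightarrow> i \<noteq> z \<Longrightarrow> cyc_pred M i \<in> arc M x c \<longleftrightarrow> i \<in> arc M x c"
proof -
  have z': "z = (if x + c + 1 < M then x + c + 1 else x + c + 1 - M)"
    using assms add_mod_eq[of x M "c + 1", folded add.assoc] by simp
  show zM: "z < M"
    using assms by simp
  show "z \<noteq> x"
    using assms(1,2) z' by auto
  note m = mem_arc[OF assms(1)] cyc_pred_mem_arc[OF assms(1)]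
  show "x \<in> arc M x c" "cyc_pred M x \<notin> arc M x c"
    using assms(1,2) by (auto simp: m)
  show "z \<notin> arc M x c" "cyc_pred M z \<in> arc M x c"
    using assms(1,2) z' zM by (auto simp: m)
  show "cyc_pred M i \<in> arc M x c \<longleftrightarrow> i \<in> arc M x c" if "i < M" "i \<noteq> x" "i \<noteq> z" for i
    using assms(1,2) z' that by (auto simp: m split: if_splits)
qed

text \<open>Of two arcs with the same end, the longer one contains the column just before the
  shorter one. But P holds on the longer arc and fails at that column.\<close>

lemma arc_start_unique:
  assumes "x < M" "c + 1 < M" "x' < M" "c' + 1 < M"
    and z: "(x + c + 1) mod M = (x' + c' + 1) mod M"
    and P: "\<And>i. i \<in> arc M x c \<Longrightarrow> P i" "\<not> P (cyc_pred M x)"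
    and P': "\<And>i. i \<in> arc M x' c' \<Longrightarrow> P i" "\<not> P (cyc_pred M x')"
  shows "x = x'" "c = c'"
proof -
  have z': "(if x + c + 1 < M then x + c + 1 else x + c + 1 - M) =
      (if x' + c' + 1 < M then x' + c' + 1 else x' + c' + 1 - M)"
    using assms(1-4) z add_mod_eq[of x M "c + 1", folded add.assoc]
      add_mod_eq[of x' M "c' + 1", folded add.assoc] by simp
  have "c = c' \<and> x = x'"
  proof (rule linorder_cases[of c c'])
    assume "c < c'"
    then have "cyc_pred M x \<in> arc M x' c'"
      using assms(1-4) z' by (auto simp: cyc_pred_mem_arc split: if_splits)
    then show ?thesis
      using P P' by blast
  next
    assume "c' < c"
    then have "cyc_pred M x' \<in> arc M x c"
      using assms(1-4) z' by (auto simp: cyc_pred_mem_arc split: if_splits)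
    then show ?thesis
      using P P' by blast
  next
    assume "c = c'"
    then show ?thesis
      using assms(1-4) z' by (auto split: if_splits)
  qed
  then show "x = x'" "c = c'"
    by auto
qed

section \<open>Local balance at a pair of vertices\<close>

text \<open>Exchanging 0 and 1 turns the seeds of up jumps into those of down jumps, with the same
  rates. The parameter a, 1 for up and 0 for down, lets one table serve both directions.\<close>

definition seed_rate :: "real \<Rightarrow> real \<Rightarrow> nat \<Rightarrow> vertex_type \<times> vertex_type \<Rightarrow> real" where
  "seed_rate q u a p =
    (if p = ((1 - a, a, 1 - a, a), (1 - a, 1 - a, 1 - a, 1 - a)) then rate_c q u
     else if p = ((a, 1 - a, 1 - a, a), (1 - a, 1 - a, 1 - a, 1 - a)) then rate_a q u
     else if p = ((1 - a, a, 1 - a, a), (1 - a, a, a, 1 - a)) then rate_b q u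
     else 0)"

text \<open>
  The rates of the time reversed process, whose jumps start where the original ones end: by
  rotation through 180 degrees, they arise from the rates above by exchanging the two vertices
  and the incoming and outgoing edges.
\<close>

definition exit_rate :: "real \<Rightarrow> real \<Rightarrow> nat \<Rightarrow> vertex_type \<times> vertex_type \<Rightarrow> real" where
  "exit_rate q u a p =
    (if p = ((1 - a, 1 - a, 1 - a, 1 - a), (1 - a, a, 1 - a, a)) then rate_c q u
     else if p = ((1 - a, 1 - a, 1 - a, 1 - a), (1 - a, a, a, 1 - a)) then rate_a q u
     else if p = ((a, 1 - a, 1 - a, a), (1 - a, a, 1 - a, a)) then rate_b q u
     else 0)"

definition pair_weight :: "real \<Rightarrow> real \<Rightarrow> vertex_type \<times> vertex_type \<Rightarrow> real" where
  "pair_weight q u p = vertex_weight q u (fst p) * vertex_weight q u (snd p)"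

text \<open>
  The common value of (rate of a seed) times (weight of the pair before the jump) over (weight of
  the pair after the jump), the same for all three types of seeds.
\<close>

definition seed_const :: "real \<Rightarrow> real \<Rightarrow> nat \<Rightarrow> real" where
  "seed_const q u a = (if a = 1 then 1 else q) / ((1 - q) * u)"

section \<open>Rates against weights at the start, the end and the interior of a jump\<close>

lemma qu_less_one: "0 < q \<Longrightarrow> q < 1 \<Longrightarrow> 0 < u \<Longrightarrow> u < 1 \<Longrightarrow> q * u < 1" for q u :: real
  using mult_strict_mono[of q 1 u 1] by simp

lemma rate_pos:
  assumes "0 < q" "q < 1" "0 < u" "u < 1"
  shows "0 < rate_a q u" "0 < rate_b q u" "0 < rate_c q u"
  using qu_less_one[OF assms] assms by (simp_all add: rate_a_def rate_b_def rate_c_def)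

lemma exit_rate_nonneg:
  assumes "0 < q" "q < 1" "0 < u" "u < 1"
  shows "0 \<le> exit_rate q u a p"
  using rate_pos[OF assms] by (simp add: exit_rate_def)

text \<open>Written through the weights, each rate is \<open>seed_const\<close> times a ratio of
  pair weights. The up and down forms agree because \<open>delta1\<close> is q times
  \<open>delta2\<close>, and \<open>seed_const\<close> at 0 is q times its value at 1.\<close>

lemma rate_delta:
  assumes "0 < q" "q < 1" "0 < u" "u < 1"
  shows rate_delta_up: "rate_a q u = seed_const q u 1 * delta1 q u"
      "rate_b q u = seed_const q u 1 / delta2 q u"
      "rate_c q u = seed_const q u 1 * (1 - delta1 q u) * (1 - delta2 q u) / delta2 q u"
    and rate_delta_down: "rate_a q u = seed_const q u 0 * delta2 q u"
      "rate_b q u = seed_const q u 0 / delta1 q u"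
      "rate_c q u = seed_const q u 0 * (1 - delta1 q u) * (1 - delta2 q u) / delta1 q u"
proof -
  have nz: "1 - q * u \<noteq> 0" "1 - q \<noteq> 0" "1 - u \<noteq> 0" "u \<noteq> 0" "q \<noteq> 0"
    using qu_less_one[OF assms] assms by simp_all
  then have 1: "1 - delta1 q u = (1 - q) / (1 - q * u)" "1 - delta2 q u = u * (1 - q) / (1 - q * u)"
    by (auto simp: delta1_def delta2_def field_simps)
  show "rate_c q u = seed_const q u 1 * (1 - delta1 q u) * (1 - delta2 q u) / delta2 q u"
    "rate_c q u = seed_const q u 0 * (1 - delta1 q u) * (1 - delta2 q u) / delta1 q u"
    unfolding 1 using nz by (simp_all add: rate_c_def delta1_def delta2_def seed_const_def mult_ac)
  show "rate_a q u = seed_const q u 1 * delta1 q u" "rate_b q u = seed_const q u 1 / delta2 q u"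
    "rate_a q u = seed_const q u 0 * delta2 q u" "rate_b q u = seed_const q u 0 / delta1 q u"
    using nz by (simp_all add: rate_a_def rate_b_def delta1_def delta2_def seed_const_def mult_ac)
qed

fun path_pair :: "vertex_type \<times> vertex_type \<Rightarrow> bool" where
  "path_pair ((B, l, V, r), (V', l', T, r')) \<longleftrightarrow>
     V' = V \<and> {B, l, V, r, l', T, r'} \<subseteq> {0, 1} \<and> B + l = V + r \<and> V + l' = T + r'"

lemma seed_rate_cases:
  assumes "seed_rate q u a p \<noteq> 0"
  shows "p = ((1 - a, a, 1 - a, a), (1 - a, 1 - a, 1 - a, 1 - a)) \<or>
    p = ((a, 1 - a, 1 - a, a), (1 - a, 1 - a, 1 - a, 1 - a)) \<or>
    p = ((1 - a, a, 1 - a, a), (1 - a, a, a, 1 - a))"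
  using assms unfolding seed_rate_def by metis

text \<open>In the first column of an arc jump the middle edge becomes a and only the right edges
  are swapped. The claim on l and l' keeps the preceding column from looking as if it had been
  swapped, so that the start can still be located after the jump.\<close>

lemma seed_start:
  assumes "0 < q" "q < 1" "0 < u" "u < 1" and a: "a \<in> {0, 1}"
    and seed: "seed_rate q u a ((B, l, V, r), (V, l', T, r')) \<noteq> 0"
  shows "V = 1 - a" "r = a" "r' = 1 - a" "\<not> (l = 1 - a \<and> l' = a)"
    "path_pair ((B, l, a, r'), (a, l', T, r))"
    "pair_weight q u ((B, l, V, r), (V, l', T, r')) * seed_rate q u a ((B, l, V, r), (V, l', T, r')) =
      seed_const q u a * pair_weight q u ((B, l, a, r'), (a, l', T, r))"
proof -
  note cases = seed_rate_cases[OF seed]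
  show "V = 1 - a" "r = a" "r' = 1 - a"
    using cases by auto
  show "\<not> (l = 1 - a \<and> l' = a)" "path_pair ((B, l, a, r'), (a, l', T, r))"
    using cases a by auto
  have nz: "delta1 q u \<noteq> 0" "delta2 q u \<noteq> 0"
    using delta_bounds[OF assms(1-4)] by simp_all
  show "pair_weight q u ((B, l, V, r), (V, l', T, r')) * seed_rate q u a ((B, l, V, r), (V, l', T, r')) =
      seed_const q u a * pair_weight q u ((B, l, a, r'), (a, l', T, r))"
  proof (cases "a = 1")
    case True
    then show ?thesis
      using cases nz
      by (elim disjE)
        (simp_all add: seed_rate_def pair_weight_def vertex_weight_def rate_delta_up[OF assms(1-4)])
  next
    case False
    then have "a = 0"
      using a by simp
    then show ?thesis
      using cases nz
      by (elim disjE)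
        (simp_all add: seed_rate_def pair_weight_def vertex_weight_def rate_delta_down[OF assms(1-4)])
  qed
qed

text \<open>In the last column the left edges are swapped and the middle edge becomes 1 - a. The
  rate of the seed does not enter: the past of the jump is felt only through the constant
  \<open>seed_const\<close>.\<close>

lemma seed_end:
  assumes "0 < q" "q < 1" "0 < u" "u < 1" and a: "a \<in> {0, 1}"
    and p: "path_pair ((B, a, V, r), (V, 1 - a, T, r'))" "\<not> (r = a \<and> r' = 1 - a)"
  shows "V = a" "path_pair ((B, 1 - a, 1 - a, r), (1 - a, a, T, r'))"
    "seed_const q u a * pair_weight q u ((B, a, V, r), (V, 1 - a, T, r')) =
      pair_weight q u ((B, 1 - a, 1 - a, r), (1 - a, a, T, r')) *
      exit_rate q u a ((B, 1 - a, 1 - a, r), (1 - a, a, T, r'))"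
proof -
  have "B \<in> {0, 1}" "V \<in> {0, 1}" "T \<in> {0, 1}" "r \<le> 1" "r' \<le> 1"
    "B + a = V + r" "V + (1 - a) = T + r'"
    using p(1) by auto
  \<comment> \<open>V = 1 - a would force r = a and r' = 1 - a by conservation. So V = a, hence r =
    B and T + r' = 1; of these four combinations the second assumption excludes one, for either
    value of a.\<close>
  then have *: "V = a \<and> (a = 1 \<and> (B, r, T, r') \<in> {(0, 0, 1, 0), (0, 0, 0, 1), (1, 1, 0, 1)} \<or>
      a = 0 \<and> (B, r, T, r') \<in> {(1, 1, 0, 1), (1, 1, 1, 0), (0, 0, 1, 0)})"
    using a p(2) unfolding insert_iff empty_iff by (elim disjE) simp_all
  then show "V = a" "path_pair ((B, 1 - a, 1 - a, r), (1 - a, a, T, r'))"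
    by auto
  have nz: "delta1 q u \<noteq> 0" "delta2 q u \<noteq> 0"
    using delta_bounds[OF assms(1-4)] by simp_all
  show "seed_const q u a * pair_weight q u ((B, a, V, r), (V, 1 - a, T, r')) =
      pair_weight q u ((B, 1 - a, 1 - a, r), (1 - a, a, T, r')) *
      exit_rate q u a ((B, 1 - a, 1 - a, r), (1 - a, a, T, r'))"
  proof (cases "a = 1")
    case True
    then show ?thesis
      using * nz unfolding insert_iff empty_iff
      by (elim conjE disjE)
        (simp_all add: exit_rate_def pair_weight_def vertex_weight_def rate_delta_up[OF assms(1-4)])
  next
    case False
    then show ?thesis
      using * nz unfolding insert_iff empty_iff
      by (elim conjE disjE)
        (simp_all add: exit_rate_def pair_weight_def vertex_weight_def rate_delta_down[OF assms(1-4)])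
  qed
qed

text \<open>Conservation gives B = V = T, so swapping both the left and the right edges merely
  exchanges the types of the two vertices. The equality of rates serves full loops, where the start
  column is also the end.\<close>

lemma seed_interior:
  assumes "a \<in> {0, 1}" "path_pair ((B, a, V, a), (V, 1 - a, T, 1 - a))"
  shows "path_pair ((B, 1 - a, V, 1 - a), (V, a, T, a))"
    "pair_weight q u ((B, 1 - a, V, 1 - a), (V, a, T, a)) =
      pair_weight q u ((B, a, V, a), (V, 1 - a, T, 1 - a))"
    "exit_rate q u a ((B, 1 - a, V, 1 - a), (V, a, T, a)) =
      seed_rate q u a ((B, a, V, a), (V, 1 - a, T, 1 - a))"
proof -
  have "T = V" "B = V" "V \<in> {0, 1}"
    using assms by auto
  then show "path_pair ((B, 1 - a, V, 1 - a), (V, a, T, a))"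
    "pair_weight q u ((B, 1 - a, V, 1 - a), (V, a, T, a)) =
      pair_weight q u ((B, a, V, a), (V, 1 - a, T, 1 - a))"
    "exit_rate q u a ((B, 1 - a, V, 1 - a), (V, a, T, a)) =
      seed_rate q u a ((B, a, V, a), (V, 1 - a, T, 1 - a))"
    using assms(1) unfolding insert_iff empty_iff
    by (elim disjE; simp add: pair_weight_def vertex_weight_def exit_rate_def seed_rate_def)+
qed

text \<open>
  Reversed and original rates differ by the discrete gradient of \<open>column_potential\<close> in the
  \<open>y\<close> direction and of a multiple of the indicator of two empty horizontal edges in the
  \<open>x\<close> direction.
\<close>

definition column_potential :: "real \<Rightarrow> real \<Rightarrow> vertex_type \<Rightarrow> real" where
  "column_potential q u t =
    (if t = (0, 0, 0, 0) then rate_a q u + rate_b q u - rate_c q u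
     else if t = (0, 1, 0, 1) then rate_a q u + rate_b q u
     else if t = (1, 1, 1, 1) then 0
     else if t = (1, 0, 1, 0) then rate_c q u
     else rate_a q u)"

text \<open>The edges r, r' of a column are l, l' of the next one, and the upper vertex is the lower
  one of the next pair, so every difference on the right telescopes around the torus. The identity
  is checked case by case on the admissible pairs.\<close>

lemma rate_telescope:
  assumes "path_pair ((B, l, V, r), (V, l', T, r'))"
  defines "p \<equiv> ((B, l, V, r), (V, l', T, r'))"
  shows "exit_rate q u 1 p + exit_rate q u 0 p - (seed_rate q u 1 p + seed_rate q u 0 p) =
    column_potential q u (V, l', T, r') - column_potential q u (B, l, V, r) +
    (rate_c q u - rate_a q u - rate_b q u) *
      (of_bool (l = 0 \<and> l' = 0) - of_bool (r = 0 \<and> r' = 0))"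
proof -
  \<comment> \<open>The case split runs over B, V, l, l' and T, with r and r' computed by
    subtraction. The inequalities discard the cases where the subtraction would be truncated or the
    result would exceed 1.\<close>
  have "B \<in> {0, 1}" "V \<in> {0, 1}" "l \<in> {0, 1}" "l' \<in> {0, 1}"
    and "r = B + l - V" "r' = V + l' - T" "T \<in> {0, 1}"
    and "V \<le> B + l" "T \<le> V + l'" "B + l \<le> V + 1" "V + l' \<le> T + 1"
    using assms(1) by auto
  then show ?thesis
    unfolding p_def insert_iff empty_iff
    by (elim disjE FalseE) (simp_all add: exit_rate_def seed_rate_def column_potential_def)
qed

section \<open>A jump in a strip of two rows\<close>

lemma sum_remove_two:
  assumes "finite A" "i \<in> A" "j \<in> A" "i \<noteq> j"
  shows "sum f A = f i + f j + sum f (A - {i, j})"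
proof -
  have "A - {i} - {j} = A - {i, j}"
    by auto
  then show ?thesis
    using sum.remove[of A i f] sum.remove[of "A - {i}" j f] assms by (simp add: add.assoc)
qed

lemma prod_remove_two:
  assumes "finite A" "i \<in> A" "j \<in> A" "i \<noteq> j"
  shows "prod f A = f i * f j * prod f (A - {i, j})"
proof -
  have "A - {i} - {j} = A - {i, j}"
    by auto
  then show ?thesis
    using prod.remove[of A i f] prod.remove[of "A - {i}" j f] assms by (simp add: mult.assoc)
qed

section \<open>Stacked pairs of vertices in a configuration\<close>

definition pair_type :: "nat \<Rightarrow> nat \<Rightarrow> config \<Rightarrow> nat \<Rightarrow> nat \<Rightarrow> vertex_type \<times> vertex_type" where
  "pair_type M N \<sigma> x y = (vertex_type M N \<sigma> x y, vertex_type M N \<sigma> x ((y + 1) mod N))"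

lemma up_rate_eq: "up_rate M N q u \<sigma> x y = seed_rate q u 1 (pair_type M N \<sigma> x y)"
  by (simp add: up_rate_def seed_rate_def pair_type_def Let_def)

lemma down_rate_eq: "down_rate M N q u \<sigma> x y = seed_rate q u 0 (pair_type M N \<sigma> x y)"
  by (simp add: down_rate_def seed_rate_def pair_type_def Let_def)

lemma vertex_type_eq:
  "vertex_type M N \<sigma> x y =
    (\<sigma> (Ver x (cyc_pred N y)), \<sigma> (Hor (cyc_pred M x) y), \<sigma> (Ver x y), \<sigma> (Hor x y))"
  by (simp add: vertex_type_def cyc_pred_def)

lemma pair_type_eq:
  assumes "y < N"
  shows "pair_type M N \<sigma> x y =
    ((\<sigma> (Ver x (cyc_pred N y)), \<sigma> (Hor (cyc_pred M x) y), \<sigma> (Ver x y), \<sigma> (Hor x y)),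
     (\<sigma> (Ver x y), \<sigma> (Hor (cyc_pred M x) ((y + 1) mod N)),
      \<sigma> (Ver x ((y + 1) mod N)), \<sigma> (Hor x ((y + 1) mod N))))"
  by (simp only: pair_type_def vertex_type_eq cyc_pred_Suc_mod[OF assms])

definition conserving :: "vertex_type \<Rightarrow> bool" where
  "conserving t = (case t of (i\<^sub>1, j\<^sub>1, i\<^sub>2, j\<^sub>2) \<Rightarrow> i\<^sub>1 + j\<^sub>1 = i\<^sub>2 + j\<^sub>2)"

lemma path_configs_iff:
  "\<sigma> \<in> path_configs M N \<longleftrightarrow> \<sigma> \<in> torus_edges M N \<rightarrow>\<^sub>E {0, 1} \<and>
    (\<forall>x<M. \<forall>y<N. conserving (vertex_type M N \<sigma> x y))"
  by (simp add: path_configs_def conserving_def)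

lemma path_pair_pair_type:
  assumes "\<sigma> \<in> path_configs M N" "x < M" "y < N"
  shows "path_pair (pair_type M N \<sigma> x y)"
proof -
  have bin: "\<sigma> e \<in> {0, 1}" if "e \<in> torus_edges M N" for e
    using assms(1) that by (auto simp: path_configs_iff)
  have y': "(y + 1) mod N < N"
    using assms(3) by simp
  have "conserving (vertex_type M N \<sigma> x y)" "conserving (vertex_type M N \<sigma> x ((y + 1) mod N))"
    using assms y' by (auto simp: path_configs_iff)
  moreover have "{\<sigma> (Ver x (cyc_pred N y)), \<sigma> (Hor (cyc_pred M x) y), \<sigma> (Ver x y), \<sigma> (Hor x y),
      \<sigma> (Hor (cyc_pred M x) ((y + 1) mod N)), \<sigma> (Ver x ((y + 1) mod N)),
      \<sigma> (Hor x ((y + 1) mod N))} \<subseteq> {0, 1}"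
    unfolding insert_subset using assms(2,3) y'
    by (intro conjI bin) (simp_all add: torus_edges_def cyc_pred_less)
  ultimately show ?thesis
    unfolding pair_type_eq[OF assms(3)] vertex_type_eq cyc_pred_Suc_mod[OF assms(3)]
    by (simp add: conserving_def)
qed

lemma conserving_if_path_pair:
  assumes "path_pair p"
  shows "conserving (fst p)" "conserving (snd p)"
  using assms by (cases p rule: path_pair.cases; simp add: conserving_def)+

text \<open>A full loop returns to its start, so its end is set to x. With this choice the end
  together with the resulting configuration determines the start for loops as well.\<close>

definition jump_end :: "nat \<Rightarrow> nat \<Rightarrow> nat \<Rightarrow> nat \<Rightarrow> nat \<Rightarrow> config \<Rightarrow> nat" where
  "jump_end M N a x y \<sigma> =
    (if \<forall>i<M. swappable M N a \<sigma> y i then x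
     else (x + (GREATEST c. \<forall>j\<le>c. swappable M N a \<sigma> y (x + j)) + 1) mod M)"

lemma jump_cases:
  assumes "x < M" "swappable M N a \<sigma> y x"
  obtains (loop) "\<forall>i<M. swappable M N a \<sigma> y i" "jump_end M N a x y \<sigma> = x"
      "jump M N a x y \<sigma> = swap_rows N y {..<M} \<sigma>"
    | (arc) c z where "c + 1 < M" "z = (x + c + 1) mod M" "\<forall>i\<in>arc M x c. swappable M N a \<sigma> y i"
      "\<not> swappable M N a \<sigma> y z" "jump_end M N a x y \<sigma> = z"
      "jump M N a x y \<sigma> = (swap_rows N y (arc M x c) \<sigma>) (Ver x y := a, Ver z y := 1 - a)"
proof (cases "\<forall>i<M. swappable M N a \<sigma> y i")
  case True
  then show ?thesis
    by (intro loop) (simp_all add: jump_end_def jump_def)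
next
  case False
  let ?s = "\<lambda>j. swappable M N a \<sigma> y (x + j)"
  have s_mod: "swappable M N a \<sigma> y (i mod M) \<longleftrightarrow> swappable M N a \<sigma> y i" for i
    by (simp add: swappable_def)
  \<comment> \<open>The greatest c is found through the first offset d that fails. It exists within
    one turn, as some column is not swappable, and it is not 0, as x itself is swappable; hence d =
    c + 1.\<close>
  define d where "d = (LEAST j. \<not> ?s j)"
  from False obtain i where i: "i < M" "\<not> swappable M N a \<sigma> y i"
    by blast
  define j where "j = (if x \<le> i then i - x else i + M - x)"
  have j: "j < M" "(x + j) mod M = i"
    using assms(1) i(1) by (auto simp: j_def)
  have "\<not> ?s j"
    using i(2) s_mod[of "x + j"] j by simp
  then have d: "\<not> ?s d" "d \<le> j"
    unfolding d_def by (rule LeastI, rule Least_le)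
  have d_min: "?s k" if "k < d" for k
    using not_less_Least[OF that[unfolded d_def]] by simp
  have "d \<noteq> 0"
    using d(1) assms(2) by (metis add.right_neutral)
  then obtain c where c: "d = c + 1"
    by (metis Suc_eq_plus1 not0_implies_Suc)
  have c_max: "(GREATEST c. \<forall>j\<le>c. ?s j) = c"
  proof (rule Greatest_equality)
    show "\<forall>j\<le>c. ?s j"
      using d_min c by simp
    show "k \<le> c" if "\<forall>j\<le>k. ?s j" for k
      using that d(1) c by (metis Suc_eq_plus1 not_less_eq_eq)
  qed
  show ?thesis
  proof (rule arc)
    show "c + 1 < M"
      using d(2) c j(1) by simp
    show "\<forall>i\<in>arc M x c. swappable M N a \<sigma> y i"
      using d_min c s_mod by (auto simp: arc_def)
    show "\<not> swappable M N a \<sigma> y ((x + c + 1) mod M)"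
      using d(1) c by (simp add: s_mod add.assoc)
    show "jump_end M N a x y \<sigma> = (x + c + 1) mod M"
      unfolding jump_end_def c_max if_not_P[OF False] by (rule refl)
    show "jump M N a x y \<sigma> =
        (swap_rows N y (arc M x c) \<sigma>) (Ver x y := a, Ver ((x + c + 1) mod M) y := 1 - a)"
      unfolding jump_def c_max if_not_P[OF False] Let_def arc_def by (rule refl)
  qed (rule refl)
qed

text \<open>One pair of adjacent rows and one direction of jumps. \<open>N \<ge> 2\<close> makes the
  two rows distinct, so a jump changes only horizontal edges in them and vertical edges between
  them.\<close>

locale six_vertex_strip =
  fixes q u :: real and M N y a :: nat
  assumes qu: "0 < q" "q < 1" "0 < u" "u < 1"
    and N: "N \<ge> 2" and y: "y < N" and a: "a \<in> {0, 1}"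
begin

abbreviation y' where "y' \<equiv> (y + 1) mod N"

lemma y'_facts: "y' < N" "y' \<noteq> y" "y \<noteq> y'" "cyc_pred N y \<noteq> y" "cyc_pred N y' = y" "cyc_pred N y < N"
  using y N cyc_pred_Suc_mod[OF y] by (auto simp: Suc_mod_eq cyc_pred_eq)

lemma row_other:
  assumes "w < N" "w \<noteq> y'"
  shows "cyc_pred N w \<noteq> y"
  using assms Suc_cyc_pred_mod[OF assms(1)] by auto

lemma config_weight_strip:
  "config_weight M N q u \<sigma> = (\<Prod>i<M. pair_weight q u (pair_type M N \<sigma> i y)) *
    (\<Prod>i<M. \<Prod>w\<in>{..<N} - {y, y'}. vertex_weight q u (vertex_type M N \<sigma> i w))"
  unfolding config_weight_def prod.distrib[symmetric]
proof (intro prod.cong refl)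
  fix i
  show "(\<Prod>w<N. vertex_weight q u (vertex_type M N \<sigma> i w)) =
      pair_weight q u (pair_type M N \<sigma> i y) *
      (\<Prod>w\<in>{..<N} - {y, y'}. vertex_weight q u (vertex_type M N \<sigma> i w))"
    using prod_remove_two[of "{..<N}" y y' "\<lambda>w. vertex_weight q u (vertex_type M N \<sigma> i w)"]
      y y'_facts(1,3)
    by (simp add: pair_weight_def pair_type_def)
qed

lemma in_path_configs_strip:
  assumes "\<sigma> \<in> torus_edges M N \<rightarrow>\<^sub>E {0, 1}"
    and "\<And>i. i < M \<Longrightarrow> path_pair (pair_type M N \<sigma> i y)"
    and "\<And>i w. i < M \<Longrightarrow> w < N \<Longrightarrow> w \<noteq> y \<Longrightarrow> w \<noteq> y' \<Longrightarrow> conserving (vertex_type M N \<sigma> i w)"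
  shows "\<sigma> \<in> path_configs M N"
  unfolding path_configs_iff
proof (intro conjI allI impI assms(1))
  fix i w assume "i < M" "w < N"
  then show "conserving (vertex_type M N \<sigma> i w)"
    using assms(3)[of i w] conserving_if_path_pair[OF assms(2), of i]
    by (cases "w = y"; cases "w = y'") (auto simp: pair_type_def)
qed

definition seed :: "config \<Rightarrow> nat \<Rightarrow> real" where
  "seed \<sigma> x = seed_rate q u a (pair_type M N \<sigma> x y)"

definition exit :: "config \<Rightarrow> nat \<Rightarrow> real" where
  "exit \<sigma> x = exit_rate q u a (pair_type M N \<sigma> x y)"

text \<open>The trace that a swap leaves: a swappable column becomes a reversed one. This makes the
  arc of a jump visible in the configuration after it.\<close>

definition reversed :: "config \<Rightarrow> nat \<Rightarrow> bool" where
  "reversed \<sigma> i \<longleftrightarrow> \<sigma> (Hor i y) = 1 - a \<and> \<sigma> (Hor i y') = a"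

lemma swappable_iff:
  "i < M \<Longrightarrow> swappable M N a \<sigma> y i \<longleftrightarrow> \<sigma> (Hor i y) = a \<and> \<sigma> (Hor i y') = 1 - a"
  by (simp add: swappable_def)

lemma seed_facts:
  assumes "x < M" "seed \<sigma> x \<noteq> 0"
  shows "\<sigma> (Ver x y) = 1 - a" "swappable M N a \<sigma> y x" "\<not> reversed \<sigma> (cyc_pred M x)"
  using seed_start[OF qu a assms(2)[unfolded seed_def pair_type_eq[OF y]]] assms(1)
  by (auto simp: swappable_iff reversed_def)

lemma swap_rows_Ver: "swap_rows N y I \<sigma> (Ver i w) = \<sigma> (Ver i w)"
  by (simp add: swap_rows_def)

lemma swap_rows_Hor:
  "swap_rows N y I \<sigma> (Hor i w) =
    (if i \<in> I then if w = y then \<sigma> (Hor i y') else if w = y' then \<sigma> (Hor i y) else \<sigma> (Hor i w)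
     else \<sigma> (Hor i w))"
  by (simp add: swap_rows_def)

lemma swap_rows_swap_rows: "swap_rows N y I (swap_rows N y I \<sigma>) = \<sigma>"
proof
  fix e show "swap_rows N y I (swap_rows N y I \<sigma>) e = \<sigma> e"
    using y'_facts(2) by (cases e) (simp_all add: swap_rows_Ver swap_rows_Hor)
qed

lemma sum_swap_rows: "(\<Sum>w<N. swap_rows N y I \<sigma> (Hor i w)) = (\<Sum>w<N. \<sigma> (Hor i w))"
proof (cases "i \<in> I")
  case True
  have "(\<Sum>w\<in>{..<N} - {y, y'}. swap_rows N y I \<sigma> (Hor i w)) =
      (\<Sum>w\<in>{..<N} - {y, y'}. \<sigma> (Hor i w))"
    by (intro sum.cong) (auto simp: swap_rows_Hor)
  then show ?thesis
    using sum_remove_two[of "{..<N}" y y' "\<lambda>w. swap_rows N y I \<sigma> (Hor i w)"]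
      sum_remove_two[of "{..<N}" y y' "\<lambda>w. \<sigma> (Hor i w)"] True y y'_facts(1-3)
    by (simp add: swap_rows_Hor)
qed (simp add: swap_rows_Hor)

lemma swap_rows_torus:
  assumes "\<sigma> \<in> torus_edges M N \<rightarrow>\<^sub>E {0, 1}" "I \<subseteq> {..<M}"
  shows "swap_rows N y I \<sigma> \<in> torus_edges M N \<rightarrow>\<^sub>E {0, 1}"
proof (rule PiE_I)
  have bin: "\<sigma> e \<in> {0, 1}" if "e \<in> torus_edges M N" for e
    using assms(1) that by auto
  fix e assume e: "e \<in> torus_edges M N"
  then have "\<sigma> e \<in> {0, 1}"
    by (rule bin)
  moreover have "\<sigma> (Hor i y) \<in> {0, 1}" "\<sigma> (Hor i y') \<in> {0, 1}" if "i < M" for i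
    using y y'_facts(1) that by (intro bin, simp add: torus_edges_def)+
  ultimately show "swap_rows N y I \<sigma> e \<in> {0, 1}"
    using assms(2) by (cases e) (auto simp: swap_rows_Ver swap_rows_Hor subset_iff)
next
  fix e assume e: "e \<notin> torus_edges M N"
  then have "swap_rows N y I \<sigma> e = \<sigma> e"
    using assms(2) y y'_facts(1)
    by (cases e) (auto simp: swap_rows_Ver swap_rows_Hor torus_edges_def subset_iff)
  then show "swap_rows N y I \<sigma> e = undefined"
    using e assms(1) by (metis PiE_arb)
qed

lemma vertex_type_other:
  assumes "w < N" "w \<noteq> y" "w \<noteq> y'"
    and "\<And>i w. w \<noteq> y \<Longrightarrow> w \<noteq> y' \<Longrightarrow> \<eta> (Hor i w) = \<sigma> (Hor i w)"
    and "\<And>i w. w \<noteq> y \<Longrightarrow> \<eta> (Ver i w) = \<sigma> (Ver i w)"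
  shows "vertex_type M N \<eta> i w = vertex_type M N \<sigma> i w"
  using assms row_other[OF assms(1,3)] by (simp add: vertex_type_eq)

text \<open>The configuration after the jump enters only through its pair in column i, so that the
  lemma covers full loops and the interior of arcs alike.\<close>

lemma swapped_pair:
  assumes "\<sigma> \<in> path_configs M N" "i < M"
    and "swappable M N a \<sigma> y i" "swappable M N a \<sigma> y (cyc_pred M i)"
    and \<eta>: "pair_type M N \<eta> i y =
      ((\<sigma> (Ver i (cyc_pred N y)), \<sigma> (Hor (cyc_pred M i) y'), \<sigma> (Ver i y), \<sigma> (Hor i y')),
       (\<sigma> (Ver i y), \<sigma> (Hor (cyc_pred M i) y), \<sigma> (Ver i y'), \<sigma> (Hor i y)))"
  shows "path_pair (pair_type M N \<eta> i y)"
    "pair_weight q u (pair_type M N \<eta> i y) = pair_weight q u (pair_type M N \<sigma> i y)"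
    "exit \<eta> i = seed \<sigma> i"
proof -
  have s: "\<sigma> (Hor i y) = a" "\<sigma> (Hor i y') = 1 - a"
    "\<sigma> (Hor (cyc_pred M i) y) = a" "\<sigma> (Hor (cyc_pred M i) y') = 1 - a"
    using assms(2-4) by (simp_all add: swappable_iff cyc_pred_less)
  note * = seed_interior[OF a, of "\<sigma> (Ver i (cyc_pred N y))" "\<sigma> (Ver i y)" "\<sigma> (Ver i y')"]
  have "path_pair (pair_type M N \<sigma> i y)"
    by (rule path_pair_pair_type[OF assms(1,2) y])
  note * = *[OF this[unfolded pair_type_eq[OF y] s]]
  show "path_pair (pair_type M N \<eta> i y)"
    "pair_weight q u (pair_type M N \<eta> i y) = pair_weight q u (pair_type M N \<sigma> i y)"
    "exit \<eta> i = seed \<sigma> i"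
    unfolding exit_def seed_def \<eta> pair_type_eq[OF y, of _ \<sigma>] s by (fact *)+
qed

section \<open>Effect of a jump on the heights and the weight\<close>

lemma in_height_configs_jump:
  assumes "\<sigma> \<in> height_configs M N k\<^sub>1 k\<^sub>2" "\<eta> \<in> path_configs M N"
    and "\<And>i. i < M \<Longrightarrow> (\<Sum>w<N. \<eta> (Hor i w)) = (\<Sum>w<N. \<sigma> (Hor i w))"
    and "(\<Sum>i<M. \<eta> (Ver i y)) = (\<Sum>i<M. \<sigma> (Ver i y))"
    and "\<And>i w. w \<noteq> y \<Longrightarrow> \<eta> (Ver i w) = \<sigma> (Ver i w)"
  shows "\<eta> \<in> height_configs M N k\<^sub>1 k\<^sub>2"
proof -
  have "(\<Sum>i<M. \<eta> (Ver i w)) = (\<Sum>i<M. \<sigma> (Ver i w))" for w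
    using assms(4,5) by (cases "w = y") simp_all
  then show ?thesis
    using assms(1-3) by (simp add: height_configs_def del: of_nat_sum)
qed

text \<open>Every column is interior, so the weight is unchanged and the rates at x agree by
  \<open>seed_interior\<close>. The last two claims are needed to undo the jump.\<close>

lemma loop_jump:
  assumes \<sigma>: "\<sigma> \<in> height_configs M N k\<^sub>1 k\<^sub>2" and x: "x < M"
    and s: "\<forall>i<M. swappable M N a \<sigma> y i"
  defines "\<eta> \<equiv> swap_rows N y {..<M} \<sigma>"
  shows "\<eta> \<in> height_configs M N k\<^sub>1 k\<^sub>2"
    "config_weight M N q u \<sigma> * seed \<sigma> x = config_weight M N q u \<eta> * exit \<eta> x"
    "\<sigma> = swap_rows N y {..<M} \<eta>"
    "\<And>i. i < M \<Longrightarrow> reversed \<eta> i"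
proof -
  have path: "\<sigma> \<in> path_configs M N"
    using \<sigma> by (simp add: height_configs_def)
  have pair: "pair_type M N \<eta> i y =
      ((\<sigma> (Ver i (cyc_pred N y)), \<sigma> (Hor (cyc_pred M i) y'), \<sigma> (Ver i y), \<sigma> (Hor i y')),
       (\<sigma> (Ver i y), \<sigma> (Hor (cyc_pred M i) y), \<sigma> (Ver i y'), \<sigma> (Hor i y)))" if "i < M" for i
    using that y'_facts(1-4)
    by (simp add: pair_type_eq[OF y] \<eta>_def swap_rows_Ver swap_rows_Hor cyc_pred_less)
  have interior: "path_pair (pair_type M N \<eta> i y)"
    "pair_weight q u (pair_type M N \<eta> i y) = pair_weight q u (pair_type M N \<sigma> i y)"
    "exit \<eta> i = seed \<sigma> i" if "i < M" for i
    using swapped_pair[OF path that _ _ pair[OF that]] s that by (simp_all add: cyc_pred_less)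
  have other: "vertex_type M N \<eta> i w = vertex_type M N \<sigma> i w" if "w < N" "w \<noteq> y" "w \<noteq> y'" for i w
    using that by (intro vertex_type_other) (simp_all add: \<eta>_def swap_rows_Ver swap_rows_Hor)
  have \<eta>_path: "\<eta> \<in> path_configs M N"
  proof (rule in_path_configs_strip)
    show "\<eta> \<in> torus_edges M N \<rightarrow>\<^sub>E {0, 1}"
      using path unfolding \<eta>_def by (intro swap_rows_torus) (simp_all add: path_configs_iff)
    show "conserving (vertex_type M N \<eta> i w)" if "i < M" "w < N" "w \<noteq> y" "w \<noteq> y'" for i w
      using path that by (simp only: other[OF that(2-4)] path_configs_iff)
  qed (rule interior)
  show "\<eta> \<in> height_configs M N k\<^sub>1 k\<^sub>2"
    using \<eta>_path by (rule in_height_configs_jump[OF \<sigma>])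
      (simp_all only: \<eta>_def sum_swap_rows swap_rows_Ver)
  show "config_weight M N q u \<sigma> * seed \<sigma> x = config_weight M N q u \<eta> * exit \<eta> x"
    using x by (simp add: config_weight_strip interior other)
  show "\<sigma> = swap_rows N y {..<M} \<eta>"
    by (simp only: \<eta>_def swap_rows_swap_rows)
  show "reversed \<eta> i" if "i < M" for i
    using s that y'_facts(2) by (auto simp: reversed_def \<eta>_def swap_rows_Hor swappable_iff)
qed

text \<open>Pair weights change only at x and z. The start trades the seed rate for
  \<open>seed_const\<close>, the end trades \<open>seed_const\<close> for the exit rate, and the
  constant cancels. The last three claims recover the old configuration from the new one and the
  arc, and mark the arc in the new one.\<close>

lemma arc_jump:
  assumes \<sigma>: "\<sigma> \<in> height_configs M N k\<^sub>1 k\<^sub>2" and x: "x < M" and seed: "seed \<sigma> x \<noteq> 0"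
    and c: "c + 1 < M" and z: "z = (x + c + 1) mod M"
    and s: "\<forall>i\<in>arc M x c. swappable M N a \<sigma> y i" "\<not> swappable M N a \<sigma> y z"
  defines "\<eta> \<equiv> (swap_rows N y (arc M x c) \<sigma>) (Ver x y := a, Ver z y := 1 - a)"
  shows "\<eta> \<in> height_configs M N k\<^sub>1 k\<^sub>2"
    "config_weight M N q u \<sigma> * seed \<sigma> x = config_weight M N q u \<eta> * exit \<eta> z"
    "\<sigma> = swap_rows N y (arc M x c) (\<eta> (Ver x y := 1 - a, Ver z y := a))"
    "\<And>i. i \<in> arc M x c \<Longrightarrow> reversed \<eta> i" "\<not> reversed \<eta> (cyc_pred M x)"
proof -
  let ?I = "arc M x c"
  note bd = arc_boundary[OF x c z]
  have I: "i < M" if "i \<in> ?I" for i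
    using that arc_subset[of M x c] x by auto
  have path: "\<sigma> \<in> path_configs M N"
    using \<sigma> by (simp add: height_configs_def)
  note path_pair = path_pair_pair_type[OF path _ y, unfolded pair_type_eq[OF y]]
  have Hor: "\<eta> (Hor i w) = swap_rows N y ?I \<sigma> (Hor i w)" for i w
    by (simp add: \<eta>_def)
  have Ver: "\<eta> (Ver i w) = (if w = y \<and> i = z then 1 - a else if w = y \<and> i = x then a else \<sigma> (Ver i w))"
    for i w
    by (simp add: \<eta>_def swap_rows_Ver)
  note eqs = pair_type_eq[OF y] Hor Ver swap_rows_Hor

  have pair_x: "pair_type M N \<eta> x y =
      ((\<sigma> (Ver x (cyc_pred N y)), \<sigma> (Hor (cyc_pred M x) y), a, \<sigma> (Hor x y')),
       (a, \<sigma> (Hor (cyc_pred M x) y'), \<sigma> (Ver x y'), \<sigma> (Hor x y)))"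
    using bd(2-4) y'_facts(1-4) by (simp add: eqs)
  have pair_z: "pair_type M N \<eta> z y =
      ((\<sigma> (Ver z (cyc_pred N y)), \<sigma> (Hor (cyc_pred M z) y'), 1 - a, \<sigma> (Hor z y)),
       (1 - a, \<sigma> (Hor (cyc_pred M z) y), \<sigma> (Ver z y'), \<sigma> (Hor z y')))"
    using bd(2,5,6) y'_facts(1-4) by (simp add: eqs)
  have pair_in: "pair_type M N \<eta> i y =
      ((\<sigma> (Ver i (cyc_pred N y)), \<sigma> (Hor (cyc_pred M i) y'), \<sigma> (Ver i y), \<sigma> (Hor i y')),
       (\<sigma> (Ver i y), \<sigma> (Hor (cyc_pred M i) y), \<sigma> (Ver i y'), \<sigma> (Hor i y)))"
    if "i \<in> ?I" "i \<noteq> x" for i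
    using that I[of i] bd(5) bd(7)[of i] y'_facts(1-4) by (auto simp: eqs)
  \<comment> \<open>Outside the arc and away from z the left edges lie outside the arc too, so
    nothing changes.\<close>
  have pair_out: "pair_type M N \<eta> i y = pair_type M N \<sigma> i y"
    if "i < M" "i \<notin> ?I" "i \<noteq> z" for i
    using that bd(3) bd(7)[of i] y'_facts(1-4) by (auto simp: eqs)
  have other: "vertex_type M N \<eta> i w = vertex_type M N \<sigma> i w" if "w < N" "w \<noteq> y" "w \<noteq> y'" for i w
    using that by (intro vertex_type_other) (simp_all add: Hor Ver swap_rows_Hor)

  note start = seed_start[OF qu a seed[unfolded seed_def pair_type_eq[OF y]]]
  \<comment> \<open>The column before z is the last one of the arc, hence swappable; this gives z
    the left edges that \<open>seed_end\<close> expects.\<close>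
  have pred_z: "\<sigma> (Hor (cyc_pred M z) y) = a" "\<sigma> (Hor (cyc_pred M z) y') = 1 - a"
    using s(1) bd(1,6) by (auto simp: swappable_iff cyc_pred_less)
  note stop = seed_end[OF qu a path_pair[OF bd(1), unfolded pred_z]
      s(2)[unfolded swappable_iff[OF bd(1)]]]
  have interior: "path_pair (pair_type M N \<eta> i y)"
    "pair_weight q u (pair_type M N \<eta> i y) = pair_weight q u (pair_type M N \<sigma> i y)"
    if "i < M" "i \<noteq> x" "i \<noteq> z" for i
  proof -
    have "path_pair (pair_type M N \<eta> i y) \<and>
      pair_weight q u (pair_type M N \<eta> i y) = pair_weight q u (pair_type M N \<sigma> i y)"
    proof (cases "i \<in> ?I")
      case True
      then show ?thesis
        using swapped_pair[OF path that(1) _ _ pair_in[OF True that(2)]] s(1) bd(7)[OF that] by simp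
    next
      case False
      then show ?thesis
        using pair_out[OF that(1) False that(3)] path_pair_pair_type[OF path that(1) y] by simp
    qed
    then show "path_pair (pair_type M N \<eta> i y)"
      "pair_weight q u (pair_type M N \<eta> i y) = pair_weight q u (pair_type M N \<sigma> i y)"
      by auto
  qed
  have \<eta>_path: "\<eta> \<in> path_configs M N"
  proof (rule in_path_configs_strip)
    have "swap_rows N y ?I \<sigma> \<in> torus_edges M N \<rightarrow>\<^sub>E {0, 1}"
      using path I by (intro swap_rows_torus) (auto simp: path_configs_iff)
    moreover have "Ver x y \<in> torus_edges M N" "Ver z y \<in> torus_edges M N"
      using x bd(1) y by (simp_all add: torus_edges_def)
    moreover have "a \<in> {0, 1}" "1 - a \<in> {0, 1}"
      using a by auto
    ultimately show "\<eta> \<in> torus_edges M N \<rightarrow>\<^sub>E {0, 1}"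
      unfolding \<eta>_def by (metis PiE_fun_upd insert_absorb)
    show "conserving (vertex_type M N \<eta> i w)" if "i < M" "w < N" "w \<noteq> y" "w \<noteq> y'" for i w
      using path that by (simp only: other[OF that(2-4)] path_configs_iff)
    show "path_pair (pair_type M N \<eta> i y)" if "i < M" for i
    proof -
      have "path_pair (pair_type M N \<eta> x y)"
        unfolding pair_x by (rule start(5))
      moreover have "path_pair (pair_type M N \<eta> z y)"
        unfolding pair_z pred_z by (rule stop(2))
      ultimately show ?thesis
        using interior(1)[OF that] by blast
    qed
  qed
  have Ver_x: "\<sigma> (Ver x y) = 1 - a" and Ver_z: "\<sigma> (Ver z y) = a"
    by (fact start(1), fact stop(1))
  show "\<eta> \<in> height_configs M N k\<^sub>1 k\<^sub>2"
  proof (rule in_height_configs_jump[OF \<sigma> \<eta>_path])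
    show "(\<Sum>w<N. \<eta> (Hor i w)) = (\<Sum>w<N. \<sigma> (Hor i w))" for i
      by (simp only: Hor sum_swap_rows)
    \<comment> \<open>The vertical edges at x and z had states 1 - a and a and now have a and 1 - a,
      so the number of occupied ones is preserved.\<close>
    have "(\<Sum>i\<in>{..<M} - {x, z}. \<eta> (Ver i y)) = (\<Sum>i\<in>{..<M} - {x, z}. \<sigma> (Ver i y))"
      by (intro sum.cong) (auto simp: Ver)
    then show "(\<Sum>i<M. \<eta> (Ver i y)) = (\<Sum>i<M. \<sigma> (Ver i y))"
      using sum_remove_two[of "{..<M}" x z "\<lambda>i. \<eta> (Ver i y)"]
        sum_remove_two[of "{..<M}" x z "\<lambda>i. \<sigma> (Ver i y)"] x bd(1,2) Ver_x Ver_z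
      by (simp add: Ver)
  qed (simp add: Ver)
  show "config_weight M N q u \<sigma> * seed \<sigma> x = config_weight M N q u \<eta> * exit \<eta> z"
  proof -
    let ?w = "\<lambda>\<sigma> i. pair_weight q u (pair_type M N \<sigma> i y)"
    have rest: "(\<Prod>i\<in>{..<M} - {x, z}. ?w \<eta> i) = (\<Prod>i\<in>{..<M} - {x, z}. ?w \<sigma> i)"
      by (intro prod.cong) (auto simp: interior)
    have 1: "?w \<sigma> x * seed \<sigma> x = seed_const q u a * ?w \<eta> x"
      unfolding seed_def pair_x pair_type_eq[OF y, of M \<sigma>] by (rule start(6))
    have 2: "seed_const q u a * ?w \<sigma> z = ?w \<eta> z * exit \<eta> z"
      unfolding exit_def pair_z pair_type_eq[OF y, of M \<sigma>] pred_z by (rule stop(3))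
    have "?w \<sigma> x * ?w \<sigma> z * seed \<sigma> x = ?w \<sigma> x * seed \<sigma> x * ?w \<sigma> z"
      by simp
    also have "\<dots> = ?w \<eta> x * (seed_const q u a * ?w \<sigma> z)"
      unfolding 1 by simp
    also have "\<dots> = ?w \<eta> x * ?w \<eta> z * exit \<eta> z"
      unfolding 2 by simp
    finally have 3: "?w \<sigma> x * ?w \<sigma> z * seed \<sigma> x = ?w \<eta> x * ?w \<eta> z * exit \<eta> z" .
    have split: "config_weight M N q u \<xi> = ?w \<xi> x * ?w \<xi> z * (\<Prod>i\<in>{..<M} - {x, z}. ?w \<xi> i) *
        (\<Prod>i<M. \<Prod>w\<in>{..<N} - {y, y'}. vertex_weight q u (vertex_type M N \<xi> i w))" for \<xi>
      using prod_remove_two[of "{..<M}" x z "?w \<xi>"] x bd(1,2) by (simp add: config_weight_strip)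
    have o: "(\<Prod>i<M. \<Prod>w\<in>{..<N} - {y, y'}. vertex_weight q u (vertex_type M N \<eta> i w)) =
        (\<Prod>i<M. \<Prod>w\<in>{..<N} - {y, y'}. vertex_weight q u (vertex_type M N \<sigma> i w))"
      by (simp add: other)
    show ?thesis
      unfolding split rest o using 3 by algebra
  qed
  have "\<eta> (Ver x y := 1 - a, Ver z y := a) = swap_rows N y ?I \<sigma>"
    using Ver_x Ver_z bd(2) by (auto simp: \<eta>_def swap_rows_Ver fun_eq_iff)
  then show "\<sigma> = swap_rows N y ?I (\<eta> (Ver x y := 1 - a, Ver z y := a))"
    by (simp only: swap_rows_swap_rows)
  show "reversed \<eta> i" if "i \<in> ?I" for i
    using s(1) that I[OF that] y'_facts(2) by (auto simp: reversed_def Hor swap_rows_Hor swappable_iff)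
  show "\<not> reversed \<eta> (cyc_pred M x)"
    using seed_facts(3)[OF x seed] bd(4) by (simp add: reversed_def Hor swap_rows_Hor)
qed

section \<open>Undoing jumps and bounding the inflow\<close>

lemma seed_jump:
  assumes "\<sigma> \<in> height_configs M N k\<^sub>1 k\<^sub>2" "x < M" "seed \<sigma> x \<noteq> 0"
  shows "jump M N a x y \<sigma> \<in> height_configs M N k\<^sub>1 k\<^sub>2" "jump_end M N a x y \<sigma> < M"
    "config_weight M N q u \<sigma> * seed \<sigma> x =
      config_weight M N q u (jump M N a x y \<sigma>) * exit (jump M N a x y \<sigma>) (jump_end M N a x y \<sigma>)"
proof -
  let ?\<eta> = "jump M N a x y \<sigma>" and ?z = "jump_end M N a x y \<sigma>"
  have "?\<eta> \<in> height_configs M N k\<^sub>1 k\<^sub>2 \<and> ?z < M \<and>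
    config_weight M N q u \<sigma> * seed \<sigma> x = config_weight M N q u ?\<eta> * exit ?\<eta> ?z"
    using assms(2) seed_facts(2)[OF assms(2,3)]
  proof (cases rule: jump_cases)
    case loop
    note * = loop_jump(1,2)[OF assms(1,2) loop(1), folded loop(3)]
    show ?thesis
      unfolding loop(2) using * assms(2) by blast
  next
    case (arc c z)
    note * = arc_jump(1,2)[OF assms arc(1-4), folded arc(6)]
    show ?thesis
      unfolding arc(5) using * arc_boundary(1)[OF assms(2) arc(1,2)] by blast
  qed
  then show "?\<eta> \<in> height_configs M N k\<^sub>1 k\<^sub>2" "?z < M"
    "config_weight M N q u \<sigma> * seed \<sigma> x = config_weight M N q u ?\<eta> * exit ?\<eta> ?z"
    by auto
qed

text \<open>A full loop leaves every column reversed, whereas an arc jump leaves a column that is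
  not; so the two kinds have different images. A loop starts at its end. The start of an arc is
  found by walking back from the end through reversed columns until the first one that is not.
  Redoing the swaps then restores the old configuration.\<close>

lemma seed_jump_inj:
  assumes "\<sigma> \<in> height_configs M N k\<^sub>1 k\<^sub>2" "x < M" "seed \<sigma> x \<noteq> 0"
    and "\<sigma>' \<in> height_configs M N k\<^sub>1 k\<^sub>2" "x' < M" "seed \<sigma>' x' \<noteq> 0"
    and jump: "jump M N a x y \<sigma> = jump M N a x' y \<sigma>'"
    and stop: "jump_end M N a x y \<sigma> = jump_end M N a x' y \<sigma>'"
  shows "\<sigma> = \<sigma>' \<and> x = x'"
proof -
  define \<eta> where "\<eta> = jump M N a x y \<sigma>"
  have \<eta>': "\<eta> = jump M N a x' y \<sigma>'"
    using jump by (simp add: \<eta>_def)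
  show ?thesis
    using assms(2) seed_facts(2)[OF assms(2,3)]
  proof (cases rule: jump_cases)
    case loop
    note 1 = loop_jump(3,4)[OF assms(1,2) loop(1), folded loop(3), folded \<eta>_def]
    show ?thesis
      using assms(5) seed_facts(2)[OF assms(5,6)]
    proof (cases rule: jump_cases)
      case loop': loop
      note 2 = loop_jump(3)[OF assms(4,5) loop'(1), folded loop'(3), folded \<eta>']
      show ?thesis
        using 1(1) 2 loop(2) loop'(2) stop by simp
    next
      case (arc c' z')
      note 2 = arc_jump(5)[OF assms(4-6) arc(1-4), folded arc(6), folded \<eta>']
      show ?thesis
        using 1(2) 2 cyc_pred_less[OF assms(5)] by blast
    qed
  next
    case (arc c z)
    note 1 = arc_jump(3-5)[OF assms(1-3) arc(1-4), folded arc(6), folded \<eta>_def]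
    show ?thesis
      using assms(5) seed_facts(2)[OF assms(5,6)]
    proof (cases rule: jump_cases)
      case loop
      note 2 = loop_jump(4)[OF assms(4,5) loop(1), folded loop(3), folded \<eta>']
      show ?thesis
        using 1(3) 2 cyc_pred_less[OF assms(2)] by blast
    next
      case arc': (arc c' z')
      note 2 = arc_jump(3-5)[OF assms(4-6) arc'(1-4), folded arc'(6), folded \<eta>']
      have zz: "z = z'"
        using arc(5) arc'(5) stop by simp
      \<comment> \<open>Being reversed is a property of the common image alone, so it can serve as
        one predicate for both arcs.\<close>
      have "x = x'" "c = c'"
        using arc_start_unique[where P = "reversed \<eta>", OF assms(2) arc(1) assms(5) arc'(1)]
          arc(2) arc'(2) zz 1(2,3) 2(2,3) by blast+
      then show ?thesis
        using 1(1) 2(1) zz by simp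
    qed
  qed
qed

text \<open>The jumps into \<eta> are reindexed by their ends, which is injective. Enlarging the
  range to all columns only adds nonnegative terms, so surjectivity need not be shown here.\<close>

lemma inflow_le:
  assumes "\<eta> \<in> height_configs M N k\<^sub>1 k\<^sub>2" "M \<ge> 1"
  defines "S \<equiv> height_configs M N k\<^sub>1 k\<^sub>2"
  shows "(\<Sum>\<sigma>\<in>S. \<Sum>x<M. if jump M N a x y \<sigma> = \<eta> then config_weight M N q u \<sigma> * seed \<sigma> x else 0) \<le>
    config_weight M N q u \<eta> * (\<Sum>z<M. exit \<eta> z)"
proof -
  let ?w = "config_weight M N q u"
  let ?end = "\<lambda>(\<sigma>, x). jump_end M N a x y \<sigma>"
  \<comment> \<open>Clocks of rate 0 are left out: \<open>jump\<close> also has a value for them,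
    but only jumps from seeds are known to be invertible.\<close>
  define A where "A = {(\<sigma>, x). \<sigma> \<in> S \<and> x < M \<and> jump M N a x y \<sigma> = \<eta> \<and> seed \<sigma> x \<noteq> 0}"
  have fin: "finite S"
    unfolding S_def by (rule finite_height_configs)
  have w: "?w \<eta> > 0"
    using assms(1,2) N by (intro config_weight_pos[OF qu]) (simp_all add: height_configs_def)
  have ends: "?end ` A \<subseteq> {..<M}"
    using seed_jump(2) by (auto simp: A_def S_def)
  have inj: "inj_on ?end A"
    using seed_jump_inj by (intro inj_onI) (auto simp: A_def S_def)
  have "(\<Sum>\<sigma>\<in>S. \<Sum>x<M. if jump M N a x y \<sigma> = \<eta> then ?w \<sigma> * seed \<sigma> x else 0) =
      (\<Sum>(\<sigma>, x)\<in>S \<times> {..<M}. if jump M N a x y \<sigma> = \<eta> then ?w \<sigma> * seed \<sigma> x else 0)"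
    by (rule sum.cartesian_product)
  also have "\<dots> = (\<Sum>(\<sigma>, x)\<in>A. if jump M N a x y \<sigma> = \<eta> then ?w \<sigma> * seed \<sigma> x else 0)"
    using fin by (intro sum.mono_neutral_right) (auto simp: A_def split: if_splits)
  also have "\<dots> = (\<Sum>p\<in>A. ?w \<eta> * exit \<eta> (?end p))"
    using seed_jump(3) by (intro sum.cong) (auto simp: A_def S_def)
  also have "\<dots> = (\<Sum>z\<in>?end ` A. ?w \<eta> * exit \<eta> z)"
    by (simp add: sum.reindex[OF inj])
  also have "\<dots> \<le> (\<Sum>z<M. ?w \<eta> * exit \<eta> z)"
    using ends w exit_rate_nonneg[OF qu] by (intro sum_mono2) (auto simp: exit_def)
  finally show ?thesis
    by (simp add: sum_distrib_left)
qed

end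

section \<open>Stationarity\<close>

definition total_rate :: "nat \<Rightarrow> nat \<Rightarrow> real \<Rightarrow> real \<Rightarrow> config \<Rightarrow> real" where
  "total_rate M N q u \<sigma> = (\<Sum>x<M. \<Sum>y<N. up_rate M N q u \<sigma> x y + down_rate M N q u \<sigma> x y)"

text \<open>The sum of \<open>rate_telescope\<close> over the torus: the potential cancels along
  each column of vertices, and the indicators of empty edges cancel between neighbouring
  columns.\<close>

lemma sum_exit_rate:
  assumes "\<sigma> \<in> path_configs M N"
  shows "(\<Sum>x<M. \<Sum>y<N. exit_rate q u 1 (pair_type M N \<sigma> x y) + exit_rate q u 0 (pair_type M N \<sigma> x y)) =
    total_rate M N q u \<sigma>"
proof -
  let ?h = "\<lambda>x y. column_potential q u (vertex_type M N \<sigma> x y)"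
  let ?e = "\<lambda>x. \<Sum>y<N. of_bool (\<sigma> (Hor x y) = 0 \<and> \<sigma> (Hor x ((y + 1) mod N)) = 0) :: real"
  let ?k = "rate_c q u - rate_a q u - rate_b q u"
  let ?p = "pair_type M N \<sigma>"
  have tel: "exit_rate q u 1 (?p x y) + exit_rate q u 0 (?p x y) -
      (seed_rate q u 1 (?p x y) + seed_rate q u 0 (?p x y)) =
      ?h x ((y + 1) mod N) - ?h x y +
      ?k * (of_bool (\<sigma> (Hor (cyc_pred M x) y) = 0 \<and> \<sigma> (Hor (cyc_pred M x) ((y + 1) mod N)) = 0) -
        of_bool (\<sigma> (Hor x y) = 0 \<and> \<sigma> (Hor x ((y + 1) mod N)) = 0))"
    if "x < M" "y < N" for x y
    using rate_telescope[of _ _ _ _ _ _ _ q u, OF path_pair_pair_type[OF assms that, unfolded pair_type_eq[OF that(2)]]]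
    unfolding pair_type_eq[OF that(2)] vertex_type_eq cyc_pred_Suc_mod[OF that(2)] .
  have "(\<Sum>x<M. \<Sum>y<N. exit_rate q u 1 (?p x y) + exit_rate q u 0 (?p x y)) - total_rate M N q u \<sigma> =
      (\<Sum>x<M. \<Sum>y<N. exit_rate q u 1 (?p x y) + exit_rate q u 0 (?p x y) -
        (seed_rate q u 1 (?p x y) + seed_rate q u 0 (?p x y)))"
    by (simp only: total_rate_def up_rate_eq down_rate_eq sum_subtractf)
  also have "\<dots> = (\<Sum>x<M. \<Sum>y<N. ?h x ((y + 1) mod N) - ?h x y +
      ?k * (of_bool (\<sigma> (Hor (cyc_pred M x) y) = 0 \<and> \<sigma> (Hor (cyc_pred M x) ((y + 1) mod N)) = 0) -
        of_bool (\<sigma> (Hor x y) = 0 \<and> \<sigma> (Hor x ((y + 1) mod N)) = 0)))"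
    by (intro sum.cong refl tel) simp_all
  also have "\<dots> = (\<Sum>x<M. (\<Sum>y<N. ?h x ((y + 1) mod N)) - (\<Sum>y<N. ?h x y)) +
      ?k * ((\<Sum>x<M. ?e (cyc_pred M x)) - (\<Sum>x<M. ?e x))"
    by (simp only: sum.distrib sum_subtractf sum_distrib_left[symmetric])
  also have "\<dots> = 0"
    by (simp only: sum_Suc_mod[of "?h _"] sum_cyc_pred[of ?e] diff_self sum.neutral_const mult_zero_right add_0_left)
  finally show ?thesis
    by simp
qed

section \<open>Balance of flows at fixed height changes\<close>

locale six_vertex_torus =
  fixes q u :: real and M N :: nat and k\<^sub>1 k\<^sub>2 :: int
  assumes qu: "0 < q" "q < 1" "0 < u" "u < 1" and M: "M \<ge> 1" and N: "N \<ge> 2"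
begin

abbreviation S where "S \<equiv> height_configs M N k\<^sub>1 k\<^sub>2"
abbreviation C where "C \<equiv> path_configs M N"
abbreviation w where "w \<equiv> config_weight M N q u"

lemma strip: "y < N \<Longrightarrow> a \<in> {0, 1} \<Longrightarrow> six_vertex_strip q u N y a"
  using qu N by unfold_locales auto

lemma jump_in_S:
  assumes "\<sigma> \<in> S" "x < M" "y < N"
  shows "up_rate M N q u \<sigma> x y \<noteq> 0 \<Longrightarrow> jump M N 1 x y \<sigma> \<in> S"
    "down_rate M N q u \<sigma> x y \<noteq> 0 \<Longrightarrow> jump M N 0 x y \<sigma> \<in> S"
  using six_vertex_strip.seed_jump(1)[OF strip assms(1,2), of y 1]
    six_vertex_strip.seed_jump(1)[OF strip assms(1,2), of y 0] assms(3)
  by (simp_all add: up_rate_eq down_rate_eq six_vertex_strip.seed_def[OF strip])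

lemma jump_rate_outside:
  assumes "\<sigma> \<in> S" "\<eta> \<notin> S"
  shows "jump_rate M N q u \<sigma> \<eta> = 0"
  unfolding jump_rate_def using assms jump_in_S[OF assms(1)] by (intro sum.neutral ballI) fastforce

text \<open>The set T is left open because the sum is taken over the sector \<open>S\<close> for the
  total flow and over all path configurations for the generator.\<close>

lemma sum_jump_rate:
  assumes \<sigma>: "\<sigma> \<in> S" and T: "finite T" "S \<subseteq> T"
  shows "(\<Sum>\<eta>\<in>T. jump_rate M N q u \<sigma> \<eta>) = total_rate M N q u \<sigma>"
proof -
  \<comment> \<open>Only a clock of nonzero rate is known to lead into \<open>S\<close>; a clock of
    rate 0 contributes nothing wherever its formal target lies.\<close>
  have delta: "(\<Sum>\<eta>\<in>T. if \<xi> = \<eta> then r else 0) = r" if "r \<noteq> 0 \<Longrightarrow> \<xi> \<in> S" for \<xi> and r :: real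
    using that T by (cases "r = 0") auto
  have "(\<Sum>\<eta>\<in>T. jump_rate M N q u \<sigma> \<eta>) = (\<Sum>x<M. \<Sum>y<N. \<Sum>\<eta>\<in>T.
      (if jump M N 1 x y \<sigma> = \<eta> then up_rate M N q u \<sigma> x y else 0)
    + (if jump M N 0 x y \<sigma> = \<eta> then down_rate M N q u \<sigma> x y else 0))"
    unfolding jump_rate_def by (subst sum.swap, intro sum.cong refl, rule sum.swap)
  also have "\<dots> = total_rate M N q u \<sigma>"
    unfolding total_rate_def sum.distrib
    by (intro sum.cong arg_cong2[where f = "(+)"] refl delta jump_in_S[OF \<sigma>]) simp_all
  finally show ?thesis .
qed

text \<open>The bounds for single strips are added over all rows and both directions, because only
  then does the sum of the exit rates become the total outflow.\<close>

lemma weighted_inflow_le: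
  assumes \<eta>: "\<eta> \<in> S"
  shows "(\<Sum>\<sigma>\<in>S. w \<sigma> * jump_rate M N q u \<sigma> \<eta>) \<le> w \<eta> * total_rate M N q u \<eta>"
proof -
  let ?in = "\<lambda>a y. \<Sum>\<sigma>\<in>S. \<Sum>x<M. if jump M N a x y \<sigma> = \<eta>
    then w \<sigma> * seed_rate q u a (pair_type M N \<sigma> x y) else 0"
  let ?out = "\<lambda>a y. w \<eta> * (\<Sum>x<M. exit_rate q u a (pair_type M N \<eta> x y))"
  have le: "?in a y \<le> ?out a y" if "y < N" "a \<in> {0, 1}" for a y
    using six_vertex_strip.inflow_le[OF strip[OF that] \<eta> M]
    by (simp only: six_vertex_strip.seed_def[OF strip[OF that]] six_vertex_strip.exit_def[OF strip[OF that]])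
  have "(\<Sum>\<sigma>\<in>S. w \<sigma> * jump_rate M N q u \<sigma> \<eta>) =
      (\<Sum>\<sigma>\<in>S. \<Sum>y<N. \<Sum>x<M.
        (if jump M N 1 x y \<sigma> = \<eta> then w \<sigma> * seed_rate q u 1 (pair_type M N \<sigma> x y) else 0) +
        (if jump M N 0 x y \<sigma> = \<eta> then w \<sigma> * seed_rate q u 0 (pair_type M N \<sigma> x y) else 0))"
    unfolding jump_rate_def up_rate_eq down_rate_eq
    by (subst sum.swap) (simp add: sum_distrib_left distrib_left if_distrib[of "\<lambda>r. _ * r"] cong: if_cong)
  also have "\<dots> = (\<Sum>y<N. ?in 1 y + ?in 0 y)"
    by (subst sum.swap) (simp only: sum.distrib)
  also have "\<dots> \<le> (\<Sum>y<N. ?out 1 y + ?out 0 y)"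
    by (intro sum_mono add_mono le) simp_all
  also have "\<dots> = w \<eta> * (\<Sum>y<N. \<Sum>x<M.
      exit_rate q u 1 (pair_type M N \<eta> x y) + exit_rate q u 0 (pair_type M N \<eta> x y))"
    by (simp only: sum.distrib sum_distrib_left distrib_left)
  also have "\<dots> = w \<eta> * total_rate M N q u \<eta>"
    using sum_exit_rate[of \<eta> M N q u] \<eta> by (subst sum.swap) (simp add: height_configs_def)
  finally show ?thesis .
qed

text \<open>The total inflow equals the total outflow, so none of the inequalities above can be strict.\<close>

lemma weighted_inflow:
  assumes \<eta>: "\<eta> \<in> S"
  shows "(\<Sum>\<sigma>\<in>S. w \<sigma> * jump_rate M N q u \<sigma> \<eta>) = w \<eta> * total_rate M N q u \<eta>"
proof (rule sum_mono_inv[OF _ weighted_inflow_le \<eta> finite_height_configs])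
  show "(\<Sum>\<eta>\<in>S. \<Sum>\<sigma>\<in>S. w \<sigma> * jump_rate M N q u \<sigma> \<eta>) = (\<Sum>\<eta>\<in>S. w \<eta> * total_rate M N q u \<eta>)"
    by (subst sum.swap)
      (simp add: sum_distrib_left[symmetric] sum_jump_rate[OF _ finite_height_configs subset_refl])
qed

text \<open>The diagonal of the generator omits the rate from a state to itself, while
  \<open>total_rate\<close> counts every clock; on the diagonal this rate is added back by the first
  term.\<close>

lemma generator_eq:
  assumes "\<sigma> \<in> S"
  shows "generator C (jump_rate M N q u) \<sigma> \<eta> =
    jump_rate M N q u \<sigma> \<eta> - (if \<sigma> = \<eta> then total_rate M N q u \<sigma> else 0)"
proof -
  have "S \<subseteq> C"
    by (auto simp: height_configs_def)
  then show ?thesis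
    using assms sum_jump_rate[OF assms finite_path_configs]
      sum.remove[OF finite_path_configs, of \<sigma> M N "jump_rate M N q u \<sigma>"]
    by (auto simp: generator_def)
qed

text \<open>Inside \<open>S\<close> this is the balance of inflow and outflow. Outside
  \<open>S\<close> nothing flows in, since jumps preserve the height changes; thus the identity
  holds for every \<eta>, as stationarity on all path configurations demands.\<close>

lemma sum_weight_generator:
  "(\<Sum>\<sigma>\<in>S. w \<sigma> * generator C (jump_rate M N q u) \<sigma> \<eta>) = 0"
proof -
  have "(\<Sum>\<sigma>\<in>S. w \<sigma> * generator C (jump_rate M N q u) \<sigma> \<eta>) =
      (\<Sum>\<sigma>\<in>S. w \<sigma> * jump_rate M N q u \<sigma> \<eta>) - (\<Sum>\<sigma>\<in>S. if \<sigma> = \<eta> then w \<sigma> * total_rate M N q u \<sigma> else 0)"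
    unfolding sum_subtractf[symmetric] by (intro sum.cong) (simp_all add: generator_eq right_diff_distrib)
  also have "\<dots> = 0"
    by (cases "\<eta> \<in> S") (simp_all add: weighted_inflow jump_rate_outside finite_height_configs)
  finally show ?thesis .
qed

end

theorem theorem8p7:
  fixes q u \<tau> :: real and M N :: nat and k\<^sub>1 k\<^sub>2 :: int
  assumes "0 < q" "q < 1" "0 < u" "u < 1"
    and "M \<ge> 1" "N \<ge> 2"
    and "height_configs M N k\<^sub>1 k\<^sub>2 \<noteq> {}"
    and "\<tau> \<ge> 0"
  shows "bind_pmf (gibbs M N q u k\<^sub>1 k\<^sub>2) (process_law M N q u \<tau>) = gibbs M N q u k\<^sub>1 k\<^sub>2"
proof -
  interpret six_vertex_torus q u M N k\<^sub>1 k\<^sub>2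
    using assms by unfold_locales
  have "N \<ge> 1"
    using N by simp
  note pmf = pmf_gibbs[OF qu M this assms(7)]
  have "S \<subseteq> C"
    by (auto simp: height_configs_def)
  have "set_pmf (gibbs M N q u k\<^sub>1 k\<^sub>2) \<subseteq> C"
    using \<open>S \<subseteq> C\<close> by (auto simp: set_pmf_iff pmf split: if_splits)
  moreover have "(\<Sum>\<sigma>\<in>C. pmf (gibbs M N q u k\<^sub>1 k\<^sub>2) \<sigma> * generator C (jump_rate M N q u) \<sigma> \<eta>) = 0" for \<eta>
  proof -
    \<comment> \<open>The chain lives on all path configurations, but the Gibbs measure vanishes
      outside \<open>S\<close>, so the sum shrinks to \<open>S\<close> and the normalising constant
      factors out.\<close>
    have "(\<Sum>\<sigma>\<in>C. pmf (gibbs M N q u k\<^sub>1 k\<^sub>2) \<sigma> * generator C (jump_rate M N q u) \<sigma> \<eta>) =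
        (\<Sum>\<sigma>\<in>S. w \<sigma> / (\<Sum>\<xi>\<in>S. w \<xi>) * generator C (jump_rate M N q u) \<sigma> \<eta>)"
      using \<open>S \<subseteq> C\<close> by (intro sum.mono_neutral_cong_right finite_path_configs) (auto simp: pmf)
    also have "\<dots> = (\<Sum>\<sigma>\<in>S. w \<sigma> * generator C (jump_rate M N q u) \<sigma> \<eta>) / (\<Sum>\<xi>\<in>S. w \<xi>)"
      by (simp add: sum_divide_distrib)
    finally show ?thesis
      by (simp add: sum_weight_generator)
  qed
  moreover have "process_law M N q u \<tau> = markov_law C (jump_rate M N q u) \<tau>"
    by (simp add: process_law_def fun_eq_iff)
  ultimately show ?thesis
    using finite_path_configs jump_rate_nonneg[OF qu] assms(8)
    by (simp only:) (rule bind_markov_law_stationary)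
qed

end
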